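(* Let $\alpha\in(0,3/2)$. If a potential $V\ge 0$ satisfies $$\sum_{n=1}^{\infty} g_n(\alpha)V_n\le 2\pi\,\frac{\Gamma(2\alpha)}{\Gamma^2(\alpha)},$$ then $(-\Delta)^\alpha\ge V$ in the sense of quadratic forms on $\ell^2(\mathbb{N})$.
   Context: $\mathbb{N}=\{1,2,3,\dots\}$. The discrete Laplacian on the half line is the bounded self-adjoint operator $-\Delta$ on $\ell^2(\mathbb{N})$ given by $(-\Delta u)_n := -u_{n-1}+2u_n-u_{n+1}$ for $n\in\mathbb{N}$, with the convention $u_0:=0$; its spectrum is $[0,4]$. For $\alpha>0$, the power $(-\Delta)^\alpha$ is defined by the functional calculus. A potential is a diagonal operator $V$ on $\ell^2(\mathbb{N})$, identified with the real sequence $\{V_n\}_{n\in\mathbb{N}}$ of its diagonal entries; $V\ge0$ means $V_n\ge 0$ for all $n$. The inequality $(-\Delta)^\alpha\ge V$ means $\langle\psi,((-\Delta)^\alpha-V)\psi\rangle\ge0$ for all $\psi\in\ell^2(\mathbb{N})$. $\Gamma$ is the Gamma function and $(a)_k:=a(a+1)\cdots(a+k-1)$ is the Pochhammer symbol. For $n\in\mathbb{N}$ and $\alpha\in(0,3/2)\setminus\{1/2,1\}$, $$g_n(\alpha):=\left(1-\frac{(\alpha)_{2n}}{(1-\alpha)_{2n}}\right)\tan(\pi\alpha),$$ and at $\alpha=1/2$ and $\alpha=1$ the value of $g_n$ is the respective limit: $$g_n\left(\tfrac12\right)=\frac4\pi\sum_{j=1}^{2n}\frac1{2j-1},\qquad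 g_n(1)=2\pi n.$$ One has $g_n(\alpha)>0$ for all $\alpha\in(0,3/2)$ and $n\in\mathbb{N}$. *)

theory Defs
  imports "HOL-Analysis.Analysis" "HOL-Computational_Algebra.Polynomial"
begin

section \<open>The Hilbert space of square-summable sequences on \<open>{1,2,3,\<dots>}\<close>\<close>

text \<open>
  Sequences are indexed by \<^typ>\<open>nat\<close>, with the entry at \<open>0\<close> forced to vanish. This realises
  both the index set \<open>{1,2,3,\<dots>}\<close> and the boundary convention \<open>u\<^sub>0 = 0\<close> of the half-line Laplacian.
\<close>

typedef ell2 = "{u :: nat \<Rightarrow> complex. u 0 = 0 \<and> summable (\<lambda>n. (norm (u n))\<^sup>2)}"
  morphisms coord Abs_ell2
  by (rule exI[of _ "\<lambda>_. 0"]) simp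

setup_lifting type_definition_ell2

lemma coord_0 [simp]: "coord u 0 = 0"
  using coord[of u] by simp

lemma summable_coord [simp]: "summable (\<lambda>n. (norm (coord u n))\<^sup>2)"
  using coord[of u] by simp

lemma ell2_eqI: "(\<And>n. coord u n = coord v n) \<Longrightarrow> u = v"
  using coord_inject by blast

lemma norm_add_sq_le: "(norm (a + b))\<^sup>2 \<le> 2 * (norm a)\<^sup>2 + 2 * (norm b)\<^sup>2"
  for a b :: "'a::real_normed_vector"
proof -
  have "(norm (a + b))\<^sup>2 \<le> (norm a + norm b)\<^sup>2"
    by (intro power_mono norm_triangle_ineq norm_ge_zero)
  also have "\<dots> \<le> 2 * (norm a)\<^sup>2 + 2 * (norm b)\<^sup>2"
    using sum_squares_bound[of "norm a" "norm b"] by (simp add: power2_sum)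
  finally show ?thesis .
qed

lemma square_summable_add:
  fixes f g :: "nat \<Rightarrow> complex"
  assumes "summable (\<lambda>n. (norm (f n))\<^sup>2)" "summable (\<lambda>n. (norm (g n))\<^sup>2)"
  shows "summable (\<lambda>n. (norm (f n + g n))\<^sup>2)"
proof (rule summable_comparison_test')
  show "summable (\<lambda>n. 2 * (norm (f n))\<^sup>2 + 2 * (norm (g n))\<^sup>2)"
    using assms by (intro summable_add summable_mult)
  show "norm ((norm (f n + g n))\<^sup>2) \<le> 2 * (norm (f n))\<^sup>2 + 2 * (norm (g n))\<^sup>2" if "n \<ge> 0" for n
    using norm_add_sq_le[of "f n" "g n"] by simp
qed

lemma square_summable_mult:
  fixes f :: "nat \<Rightarrow> complex"
  assumes "summable (\<lambda>n. (norm (f n))\<^sup>2)"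
  shows "summable (\<lambda>n. (norm (c * f n))\<^sup>2)"
  using summable_mult[OF assms, of "(norm c)\<^sup>2"] by (simp add: norm_mult power_mult_distrib)

instantiation ell2 :: real_vector
begin

lift_definition zero_ell2 :: ell2 is "\<lambda>_. 0" by simp
lift_definition plus_ell2 :: "ell2 \<Rightarrow> ell2 \<Rightarrow> ell2" is "\<lambda>u v n. u n + v n"
  by (simp add: square_summable_add)
lift_definition uminus_ell2 :: "ell2 \<Rightarrow> ell2" is "\<lambda>u n. - u n" by simp
lift_definition scaleR_ell2 :: "real \<Rightarrow> ell2 \<Rightarrow> ell2" is "\<lambda>r u n. r *\<^sub>R u n"
  using square_summable_mult by (simp add: scaleR_conv_of_real)
definition minus_ell2 :: "ell2 \<Rightarrow> ell2 \<Rightarrow> ell2" where "minus_ell2 u v = u + - v"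

instance
  by standard (unfold minus_ell2_def, (transfer; simp add: algebra_simps)+)

end

lemma coord_zero [simp]: "coord 0 n = 0"
  and coord_add [simp]: "coord (u + v) n = coord u n + coord v n"
  and coord_uminus [simp]: "coord (- u) n = - coord u n"
  and coord_scaleR [simp]: "coord (r *\<^sub>R u) n = r *\<^sub>R coord u n"
  by (transfer; simp)+

lemma coord_diff [simp]: "coord (u - v) n = coord u n - coord v n"
  unfolding minus_ell2_def coord_add coord_uminus by simp

text \<open>The complex inner product, antilinear in the first argument.\<close>

definition cinner_ell2 :: "ell2 \<Rightarrow> ell2 \<Rightarrow> complex" where
  "cinner_ell2 u v = (\<Sum>n. cnj (coord u n) * coord v n)"

lemma summable_norm_cinner: "summable (\<lambda>n. norm (cnj (coord u n) * coord v n))"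
proof (rule summable_comparison_test')
  show "summable (\<lambda>n. (norm (coord u n))\<^sup>2 + (norm (coord v n))\<^sup>2)"
    by (intro summable_add summable_coord)
  show "norm (norm (cnj (coord u n) * coord v n)) \<le> (norm (coord u n))\<^sup>2 + (norm (coord v n))\<^sup>2"
    if "n \<ge> 0" for n
  proof -
    have "0 \<le> norm (coord u n) * norm (coord v n)" by simp
    then have "norm (coord u n) * norm (coord v n)
        \<le> (norm (coord u n))\<^sup>2 + (norm (coord v n))\<^sup>2"
      using sum_squares_bound[of "norm (coord u n)" "norm (coord v n)"] by linarith
    then show ?thesis by (simp add: norm_mult)
  qed
qed

lemma summable_cinner: "summable (\<lambda>n. cnj (coord u n) * coord v n)"
  using summable_norm_cinner by (rule summable_norm_cancel)

text \<open>
  The underlying real Hilbert space, with the real part of the complex inner product. Its norm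
  and topology, and hence the operator norm, are those of the complex Hilbert space.
\<close>

instantiation ell2 :: real_inner
begin

definition inner_ell2 :: "ell2 \<Rightarrow> ell2 \<Rightarrow> real" where "inner_ell2 u v = Re (cinner_ell2 u v)"
definition norm_ell2 :: "ell2 \<Rightarrow> real" where "norm_ell2 u = sqrt (inner u u)"
definition dist_ell2 :: "ell2 \<Rightarrow> ell2 \<Rightarrow> real" where "dist_ell2 u v = norm (u - v)"
definition sgn_ell2 :: "ell2 \<Rightarrow> ell2" where "sgn_ell2 u = inverse (norm u) *\<^sub>R u"
definition uniformity_ell2 :: "(ell2 \<times> ell2) filter" where
  "uniformity_ell2 = (INF e\<in>{0<..}. principal {(x, y). dist x y < e})"
definition open_ell2 :: "ell2 set \<Rightarrow> bool" where
  "open_ell2 U \<longleftrightarrow> (\<forall>x\<in>U. eventually (\<lambda>(x', y). x' = x \<longrightarrow> y \<in> U) uniformity)"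

lemma inner_ell2_eq: "inner u v = (\<Sum>n. Re (cnj (coord u n) * coord v n))"
  unfolding inner_ell2_def cinner_ell2_def by (rule Re_suminf[OF summable_cinner])

lemma summable_inner_ell2: "summable (\<lambda>n. Re (cnj (coord u n) * coord v n))"
  by (rule summable_Re[OF summable_cinner])

lemma Re_cnj_mult_self: "Re (cnj z * z) = (norm z)\<^sup>2"
  unfolding cmod_power2 by (simp add: power2_eq_square)

instance
proof
  fix u v w :: ell2 and r :: real
  show "dist u v = norm (u - v)" by (rule dist_ell2_def)
  show "sgn u = inverse (norm u) *\<^sub>R u" by (rule sgn_ell2_def)
  show "uniformity = (INF e\<in>{0<..}. principal {(x :: ell2, y). dist x y < e})"
    by (rule uniformity_ell2_def)
  show "norm u = sqrt (inner u u)" by (rule norm_ell2_def)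
  show "inner u v = inner v u" by (simp add: inner_ell2_eq mult.commute)
  show "inner (u + v) w = inner u w + inner v w"
    unfolding inner_ell2_eq
    by (subst suminf_add[OF summable_inner_ell2 summable_inner_ell2])
      (simp add: algebra_simps)
  show "inner (r *\<^sub>R u) v = r * inner u v"
    unfolding inner_ell2_eq
    by (subst suminf_mult[OF summable_inner_ell2, symmetric]) (simp add: algebra_simps)
  show "0 \<le> inner u u"
    unfolding inner_ell2_eq Re_cnj_mult_self by (intro suminf_nonneg summable_coord) simp
  show "inner u u = 0 \<longleftrightarrow> u = 0"
    unfolding inner_ell2_eq Re_cnj_mult_self
    by (subst suminf_eq_zero_iff[OF summable_coord]) (auto intro: ell2_eqI)
next
  fix U :: "ell2 set"
  show "open U \<longleftrightarrow> (\<forall>x\<in>U. eventually (\<lambda>(x', y). x' = x \<longrightarrow> y \<in> U) uniformity)"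
    by (rule open_ell2_def)
qed

end

lemma norm_ell2_sq: "(norm u)\<^sup>2 = (\<Sum>n. (norm (coord u n))\<^sup>2)"
  unfolding power2_norm_eq_inner inner_ell2_eq Re_cnj_mult_self ..

lemma sum_coord_le: "(\<Sum>k<m. (norm (coord u k))\<^sup>2) \<le> (norm u)\<^sup>2"
  unfolding norm_ell2_sq by (rule sum_le_suminf) auto

lemma norm_coord_le: "norm (coord u n) \<le> norm u"
proof (rule power2_le_imp_le)
  have "(norm (coord u n))\<^sup>2 \<le> (\<Sum>k<Suc n. (norm (coord u k))\<^sup>2)"
    by (simp add: sum_nonneg)
  also have "\<dots> \<le> (norm u)\<^sup>2" by (rule sum_coord_le)
  finally show "(norm (coord u n))\<^sup>2 \<le> (norm u)\<^sup>2" .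
qed simp

instance ell2 :: banach
proof
  fix X :: "nat \<Rightarrow> ell2"
  assume C: "Cauchy X"
  have "Cauchy (\<lambda>i. coord (X i) n)" for n
  proof (rule metric_CauchyI)
    fix e :: real assume "e > 0"
    then obtain M where M: "\<And>i j. i \<ge> M \<Longrightarrow> j \<ge> M \<Longrightarrow> dist (X i) (X j) < e"
      using C by (metis metric_CauchyD)
    have "dist (coord (X i) n) (coord (X j) n) < e" if "i \<ge> M" "j \<ge> M" for i j
      using norm_coord_le[of "X i - X j" n] M[OF that] by (simp add: dist_norm)
    then show "\<exists>M. \<forall>i\<ge>M. \<forall>j\<ge>M. dist (coord (X i) n) (coord (X j) n) < e" by blast
  qed
  then have "\<forall>n. \<exists>l. (\<lambda>i. coord (X i) n) \<longlonglongrightarrow> l"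
    by (simp add: Cauchy_convergent_iff convergent_def)
  then obtain x where x: "\<And>n. (\<lambda>i. coord (X i) n) \<longlonglongrightarrow> x n" by metis
  have tail: "(\<Sum>k<m. (norm (coord (X i) k - x k))\<^sup>2) \<le> e\<^sup>2"
    if "i \<ge> M" "e > 0" "\<And>i j. i \<ge> M \<Longrightarrow> j \<ge> M \<Longrightarrow> dist (X i) (X j) < e" for i M m e
  proof (rule LIMSEQ_le_const2)
    show "(\<lambda>j. \<Sum>k<m. (norm (coord (X i) k - coord (X j) k))\<^sup>2)
            \<longlonglongrightarrow> (\<Sum>k<m. (norm (coord (X i) k - x k))\<^sup>2)"
      by (intro tendsto_intros x)
    have "(\<Sum>k<m. (norm (coord (X i) k - coord (X j) k))\<^sup>2) \<le> e\<^sup>2" if "j \<ge> M" for j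
    proof -
      have "(\<Sum>k<m. (norm (coord (X i) k - coord (X j) k))\<^sup>2) \<le> (norm (X i - X j))\<^sup>2"
        using sum_coord_le[of "X i - X j" m] by simp
      also have "\<dots> \<le> e\<^sup>2"
        using \<open>\<And>i j. i \<ge> M \<Longrightarrow> j \<ge> M \<Longrightarrow> dist (X i) (X j) < e\<close>[OF \<open>i \<ge> M\<close> \<open>j \<ge> M\<close>]
        by (intro power_mono) (simp_all add: dist_norm)
      finally show ?thesis .
    qed
    then show "\<exists>N. \<forall>j\<ge>N. (\<Sum>k<m. (norm (coord (X i) k - coord (X j) k))\<^sup>2) \<le> e\<^sup>2" by blast
  qed
  have summ: "summable (\<lambda>k. (norm (coord (X i) k - x k))\<^sup>2)"
    and le: "(\<Sum>k. (norm (coord (X i) k - x k))\<^sup>2) \<le> e\<^sup>2"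
    if "i \<ge> M" "e > 0" "\<And>i j. i \<ge> M \<Longrightarrow> j \<ge> M \<Longrightarrow> dist (X i) (X j) < e" for i M e
  proof -
    note b = tail[OF that]
    show s: "summable (\<lambda>k. (norm (coord (X i) k - x k))\<^sup>2)"
      by (rule bounded_imp_summable[of _ "e\<^sup>2"])
        (use b[of "Suc _"] in \<open>simp_all add: lessThan_Suc_atMost\<close>)
    show "(\<Sum>k. (norm (coord (X i) k - x k))\<^sup>2) \<le> e\<^sup>2"
      by (rule suminf_le_const[OF s b])
  qed
  obtain M1 where M1: "\<And>i j. i \<ge> M1 \<Longrightarrow> j \<ge> M1 \<Longrightarrow> dist (X i) (X j) < 1"
    using metric_CauchyD[OF C, of 1] by auto
  have "x 0 = 0" using LIMSEQ_unique[OF x[of 0]] by simp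
  moreover have "summable (\<lambda>k. (norm (x k))\<^sup>2)"
    using square_summable_add[OF summable_coord[of "X M1"], of "\<lambda>k. x k - coord (X M1) k"]
      summ[OF order_refl zero_less_one M1] by (simp add: norm_minus_commute)
  ultimately have cx: "coord (Abs_ell2 x) = x" by (simp add: Abs_ell2_inverse)
  have "X \<longlonglongrightarrow> Abs_ell2 x"
  proof (rule metric_LIMSEQ_I)
    fix e :: real assume "e > 0"
    then obtain M where M: "\<And>i j. i \<ge> M \<Longrightarrow> j \<ge> M \<Longrightarrow> dist (X i) (X j) < e / 2"
      using metric_CauchyD[OF C, of "e / 2"] by auto
    have "dist (X i) (Abs_ell2 x) < e" if "i \<ge> M" for i
    proof -
      have "(norm (X i - Abs_ell2 x))\<^sup>2 \<le> (e / 2)\<^sup>2"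
        unfolding norm_ell2_sq using le[OF that _ M] \<open>e > 0\<close> by (simp add: cx)
      then have "norm (X i - Abs_ell2 x) \<le> e / 2"
        by (rule power2_le_imp_le) (use \<open>e > 0\<close> in simp)
      then show ?thesis using \<open>e > 0\<close> by (simp add: dist_norm)
    qed
    then show "\<exists>M. \<forall>i\<ge>M. dist (X i) (Abs_ell2 x) < e" by blast
  qed
  then show "convergent X" by (rule convergentI)
qed

section \<open>Functional calculus\<close>

text \<open>
  The functions and polynomials below are real-valued: this is what is needed for self-adjoint
  operators. For a complex-linear self-adjoint operator the spectrum is real, and an inverse among the
  bounded real-linear maps is automatically complex-linear, so that
  \<open>real_spectrum\<close> is the usual spectrum.
\<close>

definition real_spectrum :: "('a::real_normed_vector \<Rightarrow>\<^sub>L 'a) \<Rightarrow> real set" where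
  "real_spectrum A = {z. \<not> (\<exists>B. B o\<^sub>L (A - z *\<^sub>R id_blinfun) = id_blinfun \<and>
                              (A - z *\<^sub>R id_blinfun) o\<^sub>L B = id_blinfun)}"

definition poly_op :: "real poly \<Rightarrow> ('a::real_normed_vector \<Rightarrow>\<^sub>L 'a) \<Rightarrow> ('a \<Rightarrow>\<^sub>L 'a)" where
  "poly_op p A = (\<Sum>i\<le>degree p. coeff p i *\<^sub>R ((\<lambda>B. A o\<^sub>L B) ^^ i) id_blinfun)"

text \<open>
  Continuous functional calculus of a bounded self-adjoint operator \<open>A\<close>, for \<open>f\<close> continuous on the
  spectrum: \<open>f(A)\<close> is the operator-norm limit of \<open>p\<^sub>k(A)\<close>, for any polynomials \<open>p\<^sub>k\<close> tending to \<open>f\<close>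
  uniformly on the spectrum.
\<close>

definition cont_calculus ::
    "(real \<Rightarrow> real) \<Rightarrow> ('a::real_normed_vector \<Rightarrow>\<^sub>L 'a) \<Rightarrow> ('a \<Rightarrow>\<^sub>L 'a)" where
  "cont_calculus f A = (THE T. \<forall>p :: nat \<Rightarrow> real poly.
     uniform_limit (real_spectrum A) (\<lambda>k. poly (p k)) f sequentially \<longrightarrow>
     (\<lambda>k. poly_op (p k) A) \<longlonglongrightarrow> T)"

section \<open>The discrete Laplacian on the half line\<close>

lift_definition neg_laplacian_fun :: "ell2 \<Rightarrow> ell2" is
  "\<lambda>u n. if n = 0 then 0 else - u (n - 1) + 2 * u n - u (n + 1)"
proof -
  fix u :: "nat \<Rightarrow> complex"
  assume u: "u 0 = 0 \<and> summable (\<lambda>n. (norm (u n))\<^sup>2)"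
  then have s: "summable (\<lambda>n. (norm (u n))\<^sup>2)" by simp
  have s1: "summable (\<lambda>n. (norm (u (Suc n)))\<^sup>2)"
    using s by (rule summable_Suc_iff[of "\<lambda>n. (norm (u n))\<^sup>2", THEN iffD2])
  have s2: "summable (\<lambda>n. (norm (u (Suc (Suc n))))\<^sup>2)"
    using s1 by (rule summable_Suc_iff[of "\<lambda>n. (norm (u (Suc n)))\<^sup>2", THEN iffD2])
  have "summable (\<lambda>n. (norm ((- 1 * u n + 2 * u (Suc n)) + - 1 * u (Suc (Suc n))))\<^sup>2)"
    by (intro square_summable_add square_summable_mult s s1 s2)
  then have "summable (\<lambda>n. (norm ((\<lambda>n. if n = 0 then 0 else
      - u (n - 1) + 2 * u n - u (n + 1)) (Suc n)))\<^sup>2)"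
    by simp
  then have "summable (\<lambda>n. (norm (if n = 0 then 0 else - u (n - 1) + 2 * u n - u (n + 1)))\<^sup>2)"
    by (rule summable_Suc_iff[of "\<lambda>n. (norm (if n = 0 then 0 else
      - u (n - 1) + 2 * u n - u (n + 1)))\<^sup>2", THEN iffD1])
  then show "(if (0::nat) = 0 then 0 else - u (0 - 1) + 2 * u 0 - u (0 + 1)) = 0 \<and>
      summable (\<lambda>n. (norm (if n = 0 then 0 else - u (n - 1) + 2 * u n - u (n + 1)))\<^sup>2)"
    by simp
qed

lemma coord_neg_laplacian_fun:
  "coord (neg_laplacian_fun u) n =
     (if n = 0 then 0 else - coord u (n - 1) + 2 * coord u n - coord u (n + 1))"
  unfolding neg_laplacian_fun.rep_eq ..

lemma bounded_linear_neg_laplacian_fun: "bounded_linear neg_laplacian_fun"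
proof (rule bounded_linear_intro)
  show "neg_laplacian_fun (u + v) = neg_laplacian_fun u + neg_laplacian_fun v" for u v
    by (rule ell2_eqI) (simp add: coord_neg_laplacian_fun)
  show "neg_laplacian_fun (r *\<^sub>R u) = r *\<^sub>R neg_laplacian_fun u" for r u
    by (rule ell2_eqI) (simp add: coord_neg_laplacian_fun algebra_simps)
  show "norm (neg_laplacian_fun u) \<le> norm u * 5" for u
  proof (rule power2_le_imp_le)
    let ?a = "\<lambda>n. (norm (coord u n))\<^sup>2"
    let ?f = "\<lambda>n. (norm (coord (neg_laplacian_fun u) n))\<^sup>2"
    have s1: "summable (\<lambda>n. ?a (Suc n))"
      by (rule summable_Suc_iff[of ?a, THEN iffD2]) simp
    have s2: "summable (\<lambda>n. ?a (Suc (Suc n)))"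
      using s1 by (rule summable_Suc_iff[of "\<lambda>n. ?a (Suc n)", THEN iffD2])
    have e1: "(\<Sum>n. ?a (Suc n)) = (norm u)\<^sup>2"
      unfolding norm_ell2_sq using suminf_split_head[OF summable_coord[of u]] by simp
    have e2: "(\<Sum>n. ?a (Suc (Suc n))) \<le> (norm u)\<^sup>2"
      using suminf_split_head[OF s1] e1 by simp
    have "(norm (neg_laplacian_fun u))\<^sup>2 = (\<Sum>n. ?f (Suc n))"
      unfolding norm_ell2_sq using suminf_split_head[OF summable_coord[of "neg_laplacian_fun u"]]
      by simp
    also have "\<dots> \<le> (\<Sum>n. 4 * ?a n + 16 * ?a (Suc n) + 2 * ?a (Suc (Suc n)))"
    proof (rule suminf_le)
      show "?f (Suc n) \<le> 4 * ?a n + 16 * ?a (Suc n) + 2 * ?a (Suc (Suc n))" for n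
        using norm_add_sq_le[of "- coord u n + 2 * coord u (Suc n)" "- coord u (Suc (Suc n))"]
          norm_add_sq_le[of "- coord u n" "2 * coord u (Suc n)"]
        by (simp add: coord_neg_laplacian_fun norm_mult power_mult_distrib)
      show "summable (\<lambda>n. ?f (Suc n))" by (rule summable_Suc_iff[of ?f, THEN iffD2]) simp
      show "summable (\<lambda>n. 4 * ?a n + 16 * ?a (Suc n) + 2 * ?a (Suc (Suc n)))"
        by (intro summable_add summable_mult s1 s2 summable_coord)
    qed
    also have "\<dots> = 4 * (norm u)\<^sup>2 + 16 * (norm u)\<^sup>2 + 2 * (\<Sum>n. ?a (Suc (Suc n)))"
    proof -
      have "(\<lambda>n. 4 * ?a n + 16 * ?a (Suc n) + 2 * ?a (Suc (Suc n))) sums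
          (4 * (\<Sum>n. ?a n) + 16 * (\<Sum>n. ?a (Suc n)) + 2 * (\<Sum>n. ?a (Suc (Suc n))))"
        by (intro sums_add sums_mult summable_sums s1 s2 summable_coord)
      then show ?thesis unfolding e1 norm_ell2_sq[symmetric] by (rule sums_unique[symmetric])
    qed
    also have "\<dots> \<le> (norm u * 5)\<^sup>2"
    proof -
      have "(norm u * 5)\<^sup>2 = 25 * (norm u)\<^sup>2" by (simp add: power_mult_distrib)
      then show ?thesis using e2 zero_le_power2[of "norm u"] by linarith
    qed
    finally show "(norm (neg_laplacian_fun u))\<^sup>2 \<le> (norm u * 5)\<^sup>2" .
  qed simp
qed

lift_definition neg_laplacian :: "ell2 \<Rightarrow>\<^sub>L ell2" is neg_laplacian_fun
  by (rule bounded_linear_neg_laplacian_fun)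

definition neg_laplacian_power :: "real \<Rightarrow> ell2 \<Rightarrow>\<^sub>L ell2" where
  "neg_laplacian_power \<alpha> = cont_calculus (\<lambda>x. x powr \<alpha>) neg_laplacian"

section \<open>Potentials and the form inequality\<close>

text \<open>
  A potential is a real sequence \<open>V\<close>, of which only the entries \<open>V n\<close> with \<open>n \<ge> 1\<close> matter. It is
  not assumed bounded, hence the natural domain of the diagonal operator;
  outside of it \<open>potential_op\<close> is meaningless.
\<close>

definition potential_dom :: "(nat \<Rightarrow> real) \<Rightarrow> ell2 set" where
  "potential_dom V = {\<psi>. summable (\<lambda>n. (norm (of_real (V n) * coord \<psi> n))\<^sup>2)}"

definition potential_op :: "(nat \<Rightarrow> real) \<Rightarrow> ell2 \<Rightarrow> ell2" where
  "potential_op V \<psi> = Abs_ell2 (\<lambda>n. of_real (V n) * coord \<psi> n)"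

lemma coord_potential_op:
  "\<psi> \<in> potential_dom V \<Longrightarrow> coord (potential_op V \<psi>) n = of_real (V n) * coord \<psi> n"
  by (simp add: potential_dom_def potential_op_def Abs_ell2_inverse)

text \<open>\<open>A \<ge> V\<close> as quadratic forms on the whole space; in particular \<open>V\<psi>\<close> is defined for every \<open>\<psi>\<close>.\<close>

definition form_ge :: "(ell2 \<Rightarrow>\<^sub>L ell2) \<Rightarrow> (nat \<Rightarrow> real) \<Rightarrow> bool" where
  "form_ge A V \<longleftrightarrow> (\<forall>\<psi>. \<psi> \<in> potential_dom V \<and>
     cinner_ell2 \<psi> (blinfun_apply A \<psi> - potential_op V \<psi>) \<in> \<real>\<^sub>\<ge>\<^sub>0)"

section \<open>The weights\<close>

definition g_weight :: "nat \<Rightarrow> real \<Rightarrow> real" where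
  "g_weight n \<alpha> =
     (if \<alpha> = 1 / 2 then 4 / pi * (\<Sum>j = 1..2 * n. 1 / (2 * real j - 1))
      else if \<alpha> = 1 then 2 * pi * real n
      else (1 - pochhammer \<alpha> (2 * n) / pochhammer (1 - \<alpha>) (2 * n)) * tan (pi * \<alpha>))"

end

theory Submission
  imports Defs
begin

text \<open>
  Expanding in the functions \<open>sin (n\<theta>)\<close> on \<open>[0, \<pi>]\<close> turns \<open>- \<Delta>\<close> into multiplication by
  \<open>2 - 2 cos \<theta>\<close>. Writing \<open>f\<close> for the sine series of \<open>\<psi>\<close>, one has
  \<open>\<psi>\<^sub>n = 2/\<pi> \<integral> f(\<theta>) sin (n\<theta>) d\<theta>\<close> and
  \<open>\<langle>\<psi>, (- \<Delta>)\<^sup>\<alpha> \<psi>\<rangle> = 2/\<pi> \<integral> (2 - 2 cos \<theta>)\<^sup>\<alpha> |f(\<theta>)|\<^sup>2 d\<theta>\<close>.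
  Distributing the powers \<open>\<plusminus>\<alpha>/2\<close> of \<open>2 - 2 cos \<theta>\<close> over the two factors of \<open>f(\<theta>) sin (n\<theta>)\<close>, the
  Cauchy-Schwarz inequality yields (\<open>coord_sq_le_form\<close>)
  \<open>|\<psi>\<^sub>n|\<^sup>2 \<le> G\<^sub>n \<langle>\<psi>, (- \<Delta>)\<^sup>\<alpha> \<psi>\<rangle>\<close>, where
  \<open>G\<^sub>n = 2/\<pi> \<integral> (2 - 2 cos \<theta>) powr (- \<alpha>) sin\<^sup>2 (n\<theta>) d\<theta>\<close>
  is the diagonal of the Green kernel of \<open>(- \<Delta>)\<^sup>\<alpha>\<close>; it is finite for \<open>\<alpha> < 3/2\<close> because
  \<open>sin\<^sup>2 (n\<theta>)\<close> vanishes to second order at \<open>0\<close>.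
  Multiplying by \<open>V\<^sub>n \<ge> 0\<close> and summing, \<open>\<Sum> V\<^sub>n |\<psi>\<^sub>n|\<^sup>2\<close> is at most
  \<open>(\<Sum> G\<^sub>n V\<^sub>n) \<langle>\<psi>, (- \<Delta>)\<^sup>\<alpha> \<psi>\<rangle>\<close>, and the hypothesis says \<open>\<Sum> G\<^sub>n V\<^sub>n \<le> 1\<close>, because
  \<open>G\<^sub>n = \<Gamma>(\<alpha>)\<^sup>2 / (2\<pi> \<Gamma>(2\<alpha>)) g\<^sub>n(\<alpha>)\<close>.

  This closed form (\<open>has_integral_green_diagonal\<close>) comes from \<open>2 sin\<^sup>2 (n\<theta>) = 1 - cos (2n\<theta>)\<close>: the
  integrals of \<open>(2 - 2 cos \<theta>) powr (- \<alpha>) (1 - cos (m\<theta>))\<close> converge for every \<open>\<alpha> < 3/2\<close>, satisfy a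
  first-order recurrence in \<open>m\<close> that is solved by the Pochhammer quotients of \<open>g\<^sub>n\<close> (and by its
  limit forms at \<open>\<alpha> = 1/2\<close> and \<open>\<alpha> = 1\<close>), and start at \<open>m = 1\<close> with a Beta integral. Working with
  \<open>1 - cos (m\<theta>)\<close> instead of \<open>cos (m\<theta>)\<close> avoids analytic continuation past \<open>\<alpha> = 1/2\<close>.

  The identity for the form has to be extracted from the functional calculus. For finitely supported
  sequences the sine series are finite sums of continuous functions, so that Parseval's identity is
  just orthogonality, and it gives \<open>\<parallel>p(- \<Delta>)\<parallel> \<le> max |p|\<close> over \<open>[0, 4]\<close> for polynomials \<open>p\<close>. As the
  spectrum lies between \<open>(0, 4)\<close> and \<open>[0, 4]\<close>, uniform convergence of polynomials on the spectrum
  forces convergence of the operators (\<open>cont_calculus_neg_laplacian\<close>), and the form of \<open>f(- \<Delta>)\<close> is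
  the limit of the forms of approximating polynomials (\<open>cont_calculus_form\<close>). The pointwise bound extends to
  the whole space by density.
\<close>

section \<open>Integrals of powers of the symbol\<close>

text \<open>
  The multiplier that represents \<open>- \<Delta>\<close> under the sine transform.
\<close>

definition symbol :: "real \<Rightarrow> real" where
  "symbol \<theta> = 2 - 2 * cos \<theta>"

lemma symbol_bounds: "0 \<le> symbol \<theta>" "symbol \<theta> \<le> 4"
  using cos_le_one[of \<theta>] cos_ge_minus_one[of \<theta>] unfolding symbol_def by linarith+

lemma symbol_pos:
  assumes "0 < \<theta>" "\<theta> < pi"
  shows "0 < symbol \<theta>"
  using cos_monotone_0_pi[of 0 \<theta>] assms by (simp add: symbol_def)

lemma continuous_on_symbol [continuous_intros]: "continuous_on S symbol"
  unfolding symbol_def by (intro continuous_intros)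

lemma symbol_half_angle: "symbol \<theta> = (2 * sin (\<theta> / 2))\<^sup>2"
  using cos_double_sin[of "\<theta> / 2"] by (simp add: symbol_def power_mult_distrib)

lemma symbol_powr:
  assumes "0 < \<theta>" "\<theta> < pi"
  shows "symbol \<theta> powr a = (2 * sin (\<theta> / 2)) powr (2 * a)"
proof -
  have "0 < sin (\<theta> / 2)" using assms by (intro sin_gt_zero) auto
  then have "symbol \<theta> = (2 * sin (\<theta> / 2)) powr 2"
    unfolding symbol_half_angle by simp
  then show ?thesis by (simp add: powr_powr)
qed

text \<open>
  Under the substitution \<open>t = sin\<^sup>2 (\<theta>/2)\<close>, which maps \<open>(0, \<pi>)\<close> onto \<open>(0, 1)\<close>, the integrand becomes
  a multiple of \<open>t powr (1/2 - \<alpha>) (1 - t) powr (- 1/2)\<close>.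
\<close>

lemma has_integral_one_minus_cos_1:
  fixes \<alpha> :: real
  assumes "\<alpha> < 3 / 2"
  shows "((\<lambda>\<theta>. symbol \<theta> powr (- \<alpha>) * (1 - cos \<theta>)) has_integral
           4 powr (1 - \<alpha>) / 2 * Beta (3 / 2 - \<alpha>) (1 / 2)) {0..pi}"
proof -
  define B where "B = Beta (3 / 2 - \<alpha>) (1 / 2)"
  define f where "f = (\<lambda>t::real. t powr (1 / 2 - \<alpha>) * (1 - t) powr (- (1 / 2)))"
  let ?g = "\<lambda>\<theta>::real. (sin (\<theta> / 2))\<^sup>2"
  let ?g' = "\<lambda>\<theta>::real. sin (\<theta> / 2) * cos (\<theta> / 2)"
  have "(f has_integral B) {0<..<1}"
    unfolding f_def B_def
    using has_integral_Beta_real[of "3 / 2 - \<alpha>" "1 / 2"] assms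
    by (simp add: has_integral_Icc_iff_Ioo)
  then have f: "f absolutely_integrable_on {0<..<1}" "integral {0<..<1} f = B"
    by (auto intro!: nonnegative_absolutely_integrable_1 simp: f_def)
  have pos: "0 < sin (\<theta> / 2)" "0 < cos (\<theta> / 2)" if "\<theta> \<in> {0<..<pi}" for \<theta>
    using that by (auto intro!: sin_gt_zero cos_gt_zero_pi)
  have img: "?g ` {0<..<pi} = {0<..<1}"
  proof (intro equalityI subsetI)
    fix t :: real assume "t \<in> ?g ` {0<..<pi}"
    then obtain \<theta> where \<theta>: "\<theta> \<in> {0<..<pi}" "t = ?g \<theta>" by blast
    have "?g \<theta> + (cos (\<theta> / 2))\<^sup>2 = 1" by simp
    moreover have "0 < ?g \<theta>" "0 < (cos (\<theta> / 2))\<^sup>2" using pos[OF \<theta>(1)] by simp_all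
    ultimately show "t \<in> {0<..<1}"
      unfolding \<theta>(2) greaterThanLessThan_iff by linarith
  next
    fix t :: real assume t: "t \<in> {0<..<1}"
    define \<theta> where "\<theta> = 2 * arcsin (sqrt t)"
    have s: "0 < sqrt t" "sqrt t < 1" using t by auto
    have "0 < arcsin (sqrt t)" using arcsin_less_mono[of 0 "sqrt t"] s by simp
    moreover have "arcsin (sqrt t) < pi / 2" using arcsin_less_mono[of "sqrt t" 1] s by simp
    moreover have "sin (arcsin (sqrt t)) = sqrt t" by (rule sin_arcsin) (use s in linarith)+
    then have "?g \<theta> = t" using t by (simp add: \<theta>_def)
    ultimately show "t \<in> ?g ` {0<..<pi}" unfolding image_iff
      by (intro bexI[of _ \<theta>]) (auto simp: \<theta>_def)
  qed
  have inj: "inj_on ?g {0<..<pi}"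
  proof (rule inj_onI)
    fix x y :: real assume xy: "x \<in> {0<..<pi}" "y \<in> {0<..<pi}" "?g x = ?g y"
    then have "sin (x / 2) = sin (y / 2)" using pos by (simp add: power2_eq_iff_nonneg less_imp_le)
    then show "x = y" using xy sin_inj_pi[of "x / 2" "y / 2"] by auto
  qed
  have "(\<lambda>\<theta>. \<bar>?g' \<theta>\<bar> * f (?g \<theta>)) absolutely_integrable_on {0<..<pi} \<and>
        integral {0<..<pi} (\<lambda>\<theta>. \<bar>?g' \<theta>\<bar> * f (?g \<theta>)) = B"
  proof (subst has_absolute_integral_change_of_variables_1'[where g = ?g])
    show "(?g has_field_derivative ?g' \<theta>) (at \<theta> within {0<..<pi})" for \<theta>
      by (auto intro!: derivative_eq_intros)
    show "f absolutely_integrable_on ?g ` {0<..<pi} \<and> integral (?g ` {0<..<pi}) f = B"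
      unfolding img using f by simp
  qed (use inj in auto)
  then have "((\<lambda>\<theta>. \<bar>?g' \<theta>\<bar> * f (?g \<theta>)) has_integral B) {0<..<pi}"
    by (auto simp: has_integral_iff absolutely_integrable_on_def)
  then have "((\<lambda>\<theta>. 4 powr (1 - \<alpha>) / 2 * (\<bar>?g' \<theta>\<bar> * f (?g \<theta>))) has_integral 4 powr (1 - \<alpha>) / 2 * B)
      {0<..<pi}"
    by (rule has_integral_mult_right)
  moreover have "4 powr (1 - \<alpha>) / 2 * (\<bar>?g' \<theta>\<bar> * f (?g \<theta>)) = symbol \<theta> powr (- \<alpha>) * (1 - cos \<theta>)"
    if \<theta>: "\<theta> \<in> {0<..<pi}" for \<theta>
  proof -
    define s c where "s = sin (\<theta> / 2)" and "c = cos (\<theta> / 2)"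
    have sc: "0 < s" "0 < c" using pos[OF \<theta>] by (auto simp: s_def c_def)
    have c2: "1 - s\<^sup>2 = c\<^sup>2" by (simp add: s_def c_def cos_squared_eq)
    have "f (s\<^sup>2) = s powr (1 - 2 * \<alpha>) * c powr (- 1)"
      unfolding f_def c2 using sc by (simp add: powr_powr algebra_simps flip: powr_numeral)
    then have "\<bar>s * c\<bar> * f (s\<^sup>2) = s powr 1 * s powr (1 - 2 * \<alpha>)"
      using sc by (simp add: powr_minus field_simps)
    also have "\<dots> = s powr (2 - 2 * \<alpha>)" unfolding powr_add[symmetric] by simp
    finally have l: "\<bar>s * c\<bar> * f (s\<^sup>2) = s powr (2 - 2 * \<alpha>)" .
    have "symbol \<theta> = 4 * s\<^sup>2"
      by (simp add: symbol_half_angle s_def power_mult_distrib)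
    moreover have "1 - cos \<theta> = symbol \<theta> powr 1 / 2"
      using symbol_bounds(1)[of \<theta>] by (simp add: symbol_def)
    ultimately
    have "symbol \<theta> powr (- \<alpha>) * (1 - cos \<theta>) = (4 * s\<^sup>2) powr (1 - \<alpha>) / 2"
      using powr_mult_base[of "4 * s\<^sup>2" "- \<alpha>"] by (simp add: mult_ac)
    also have "\<dots> = 4 powr (1 - \<alpha>) / 2 * s powr (2 - 2 * \<alpha>)"
      using sc by (simp add: powr_mult powr_powr algebra_simps flip: powr_numeral)
    finally show ?thesis using l by (simp add: s_def c_def)
  qed
  ultimately show ?thesis
    unfolding B_def has_integral_Icc_iff_Ioo by (subst has_integral_cong) auto
qed

lemma abs_sin_mult_le: "\<bar>sin (real n * x)\<bar> \<le> real n * \<bar>sin x\<bar>"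
proof (induction n)
  case (Suc n)
  have "\<bar>sin (real (Suc n) * x)\<bar> \<le> \<bar>sin x * cos (real n * x)\<bar> + \<bar>cos x * sin (real n * x)\<bar>"
    by (simp add: ring_distribs sin_add)
  also have "\<dots> \<le> \<bar>sin x\<bar> * 1 + 1 * (real n * \<bar>sin x\<bar>)"
    unfolding abs_mult by (intro add_mono mult_mono Suc abs_cos_le_one) auto
  finally show ?case by (simp add: ring_distribs)
qed simp

text \<open>
  The integrand is the derivative of
  \<open>(2 sin (\<theta>/2)) powr (1 - 2\<alpha>) (cos (\<theta>/2) - cos ((m + 1/2)\<theta>))\<close>, which vanishes at both ends of
  the interval: at \<open>\<pi>\<close> because both cosines do, and at \<open>0\<close> because their difference is of order
  \<open>\<theta>\<^sup>2\<close>, so that the product is of order \<open>\<theta> powr (3 - 2\<alpha>)\<close>.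
\<close>

lemma has_integral_one_minus_cos_recurrence:
  fixes \<alpha> :: real and m :: nat
  assumes "\<alpha> < 3 / 2"
  shows "((\<lambda>\<theta>. symbol \<theta> powr (- \<alpha>) *
            ((real m + 1 - \<alpha>) * (1 - cos (real (Suc m) * \<theta>)) - (real m + \<alpha>) * (1 - cos (real m * \<theta>))
              - (1 - \<alpha>) * (1 - cos \<theta>))) has_integral 0) {0..pi}"
proof -
  define F where "F = (\<lambda>\<theta>::real. (2 * sin (\<theta> / 2)) powr (1 - 2 * \<alpha>) *
    (cos (\<theta> / 2) - cos ((real m + 1 / 2) * \<theta>)))"
  define f where "f = (\<lambda>\<theta>. symbol \<theta> powr (- \<alpha>) *
            ((real m + 1 - \<alpha>) * (1 - cos (real (Suc m) * \<theta>)) - (real m + \<alpha>) * (1 - cos (real m * \<theta>))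
              - (1 - \<alpha>) * (1 - cos \<theta>)))"
  have F0: "F 0 = 0" by (simp add: F_def)
  have Fpi: "F pi = 0"
  proof -
    have "cos ((real m + 1 / 2) * pi) = 0"
      using cos_zero_iff_int2[of "(real m + 1 / 2) * pi"]
      by (auto simp: algebra_simps intro!: exI[of _ "int m"])
    then show ?thesis by (simp add: F_def)
  qed
  have pos: "0 < sin (\<theta> / 2)" if "\<theta> \<in> {0<..pi}" for \<theta>
    using that by (auto intro!: sin_gt_zero)
  have der: "(F has_vector_derivative f \<theta>) (at \<theta>)" if \<theta>: "\<theta> \<in> {0<..<pi}" for \<theta>
  proof -
    define s where "s = sin (\<theta> / 2)"
    define c where "c = cos (\<theta> / 2)"
    define p where "p = (real m + 1 / 2) * \<theta>"
    have s: "0 < s" using pos[of \<theta>] \<theta> by (simp add: s_def)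
    have e: "(2 * s) powr (1 - 2 * \<alpha>) = (2 * s) powr (- 2 * \<alpha>) * (2 * s)"
      using s powr_add[of "2 * s" "- 2 * \<alpha>" 1] by simp
    have w: "symbol \<theta> powr (- \<alpha>) = (2 * s) powr (- 2 * \<alpha>)"
      using symbol_powr[of \<theta> "- \<alpha>"] \<theta> by (simp add: s_def)
    have half: "\<theta> / 2 + \<theta> / 2 = \<theta>" by simp
    have c1: "cos \<theta> = c * c - s * s"
      using cos_add[of "\<theta> / 2" "\<theta> / 2"] unfolding half by (simp add: c_def s_def)
    have sc: "s * s + c * c = 1"
      using sin_cos_squared_add[of "\<theta> / 2"] by (simp add: s_def c_def power2_eq_square)
    have e1: "real (Suc m) * \<theta> = p + \<theta> / 2" and e2: "real m * \<theta> = p - \<theta> / 2"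
      by (simp_all add: p_def algebra_simps)
    have cm: "cos (real (Suc m) * \<theta>) = cos p * c - sin p * s" "cos (real m * \<theta>) = cos p * c + sin p * s"
      unfolding e1 e2 cos_add cos_diff c_def s_def by simp_all
    have "(F has_real_derivative
        (1 - 2 * \<alpha>) * (2 * s) powr (- 2 * \<alpha>) * c * (c - cos p)
        + (2 * s) powr (1 - 2 * \<alpha>) * ((real m + 1 / 2) * sin p - s / 2)) (at \<theta>)"
      unfolding F_def s_def c_def p_def using s
      by (auto intro!: derivative_eq_intros simp: s_def)
    also have "(1 - 2 * \<alpha>) * (2 * s) powr (- 2 * \<alpha>) * c * (c - cos p)
        + (2 * s) powr (1 - 2 * \<alpha>) * ((real m + 1 / 2) * sin p - s / 2) =
        (2 * s) powr (- 2 * \<alpha>) * ((1 - 2 * \<alpha>) * (c * c - c * cos p) + (2 * real m + 1) * s * sin p - s * s)"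
      unfolding e by (simp add: algebra_simps)
    also have "(1 - 2 * \<alpha>) * (c * c - c * cos p) + (2 * real m + 1) * s * sin p - s * s =
        (real m + 1 - \<alpha>) * (1 - cos (real (Suc m) * \<theta>)) - (real m + \<alpha>) * (1 - cos (real m * \<theta>))
              - (1 - \<alpha>) * (1 - cos \<theta>)"
    proof -
      have cc: "c * c = 1 - s * s" using sc by simp
      show ?thesis unfolding cm c1 cc by (simp add: algebra_simps)
    qed
    finally show ?thesis
      unfolding f_def w has_real_derivative_iff_has_vector_derivative .
  qed
  have cont: "continuous_on {0..pi} F"
    unfolding continuous_on_def
  proof
    fix x assume x: "x \<in> {0..pi}"
    show "(F \<longlongrightarrow> F x) (at x within {0..pi})"
    proof (cases "x = 0")
      case False
      then have "0 < sin (x / 2)" using pos x by simp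
      then have "isCont F x" unfolding F_def by (intro continuous_intros) auto
      then show ?thesis by (simp add: isCont_def tendsto_within_subset[of _ _ _ UNIV])
    next
      case True
      \<comment> \<open>a majorant of \<open>F\<close>, obtained from \<open>|sin (k x)| \<le> k |sin x|\<close>\<close>
      let ?b = "\<lambda>\<theta>::real. real m * real (m + 1) / 2 * (2 * sin (\<theta> / 2)) powr (3 - 2 * \<alpha>)"
      have "(F \<longlongrightarrow> 0) (at 0 within {0..pi})"
      proof (rule Lim_null_comparison)
        have "norm (F \<theta>) \<le> ?b \<theta>" if "\<theta> \<in> {0..pi}" "\<theta> \<noteq> 0" for \<theta>
        proof -
          define s where "s = sin (\<theta> / 2)"
          have s: "0 < s" using pos that by (simp add: s_def)
          have "cos (\<theta> / 2) - cos ((real m + 1 / 2) * \<theta>) =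
              2 * sin (real (m + 1) * (\<theta> / 2)) * sin (real m * (\<theta> / 2))"
          proof -
            have "(\<theta> / 2 + (real m + 1 / 2) * \<theta>) / 2 = real (m + 1) * (\<theta> / 2)"
              "((real m + 1 / 2) * \<theta> - \<theta> / 2) / 2 = real m * (\<theta> / 2)"
              by (simp_all add: field_simps)
            then show ?thesis by (simp only: cos_diff_cos)
          qed
          also have "\<bar>\<dots>\<bar> \<le> 2 * (real (m + 1) * s) * (real m * s)"
            using abs_sin_mult_le[of "m + 1" "\<theta> / 2"] abs_sin_mult_le[of m "\<theta> / 2"] s
            unfolding abs_mult s_def[symmetric] by (intro mult_mono) auto
          also have "\<dots> = real m * real (m + 1) / 2 * (2 * s) powr 2"
            using s by (simp add: power2_eq_square)
          finally have "norm (F \<theta>) \<le> (2 * s) powr (1 - 2 * \<alpha>) *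
              (real m * real (m + 1) / 2 * (2 * s) powr 2)"
            unfolding F_def s_def[symmetric] real_norm_def abs_mult
            by (intro mult_mono) auto
          also have "\<dots> = ?b \<theta>"
            using powr_add[of "2 * s" "1 - 2 * \<alpha>" 2] s by (simp add: s_def)
          finally show ?thesis .
        qed
        then show "\<forall>\<^sub>F \<theta> in at 0 within {0..pi}. norm (F \<theta>) \<le> ?b \<theta>"
          unfolding eventually_at_filter by (intro always_eventually) auto
        have "(?b \<longlongrightarrow> real m * real (m + 1) / 2 * 0) (at 0 within {0..pi})"
        proof (intro tendsto_mult tendsto_const)
          have "((\<lambda>\<theta>::real. (2 * sin (\<theta> / 2)) powr (3 - 2 * \<alpha>)) \<longlongrightarrow> (2 * sin (0 / 2)) powr (3 - 2 * \<alpha>)) (at 0 within {0..pi})"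
            using assms pos
            by (intro tendsto_intros) (auto simp: eventually_at_filter less_imp_le intro!: always_eventually)
          then show "((\<lambda>\<theta>::real. (2 * sin (\<theta> / 2)) powr (3 - 2 * \<alpha>)) \<longlongrightarrow> 0) (at 0 within {0..pi})"
            by simp
        qed
        then show "(?b \<longlongrightarrow> 0) (at 0 within {0..pi})" by simp
      qed
      then show ?thesis using True F0 by simp
    qed
  qed
  show ?thesis
    using fundamental_theorem_of_calculus_interior[of 0 pi F f] cont der F0 Fpi by (simp add: f_def)
qed


text \<open>
  The weight \<open>g\<^sub>n\<close> belongs to the frequency \<open>2n\<close> of \<open>cos (2n\<theta>)\<close>. The recurrence steps through all
  frequencies, so the formula is needed for odd ones too.
\<close>

definition frequency_weight :: "nat \<Rightarrow> real \<Rightarrow> real" where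
  "frequency_weight m \<alpha> =
     (if \<alpha> = 1 / 2 then 4 / pi * (\<Sum>j = 1..m. 1 / (2 * real j - 1))
      else if \<alpha> = 1 then pi * real m
      else (1 - pochhammer \<alpha> m / pochhammer (1 - \<alpha>) m) * tan (pi * \<alpha>))"

lemma g_weight_eq_frequency_weight: "g_weight n \<alpha> = frequency_weight (2 * n) \<alpha>"
  by (simp add: g_weight_def frequency_weight_def)

text \<open>
  The same recurrence as for the integrals. Away from the two exceptional exponents it holds because
  the quotient \<open>(\<alpha>)\<^sub>m / (1 - \<alpha>)\<^sub>m\<close> is multiplied by \<open>(\<alpha> + m) / (1 - \<alpha> + m)\<close> when \<open>m\<close> grows by one,
  and the constant sequence contributes \<open>(m + 1 - \<alpha>) - (m + \<alpha>) = 1 - 2\<alpha>\<close>,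
  which matches the last term.
\<close>

lemma frequency_weight_recurrence:
  fixes \<alpha> :: real and m :: nat
  assumes "\<alpha> < 3 / 2" "m \<ge> 1"
  shows "(real m + 1 - \<alpha>) * frequency_weight (Suc m) \<alpha> = (real m + \<alpha>) * frequency_weight m \<alpha> + (1 - \<alpha>) * frequency_weight 1 \<alpha>"
proof -
  consider "\<alpha> = 1 / 2" | "\<alpha> = 1" | "\<alpha> \<noteq> 1 / 2" "\<alpha> \<noteq> 1" by blast
  then show ?thesis
  proof cases
    case 1
    define \<sigma> where "\<sigma> = (\<Sum>j = 1..m. 1 / (2 * real j - 1))"
    have "frequency_weight (Suc m) \<alpha> = 4 / pi * (\<sigma> + 1 / (2 * real m + 1))" "frequency_weight m \<alpha> = 4 / pi * \<sigma>"
      "frequency_weight 1 \<alpha> = 4 / pi"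
      using 1 by (simp_all add: frequency_weight_def \<sigma>_def)
    moreover have "(real m + 1 - 1 / 2) * (p * (\<sigma> + 1 / (2 * real m + 1))) =
        (real m + 1 / 2) * (p * \<sigma>) + (1 - 1 / 2) * p" for p :: real
    proof -
      define d where "d = 2 * real m + 1"
      have "0 < d" by (simp add: d_def)
      then have "d / 2 * (p * (\<sigma> + 1 / d)) = d / 2 * (p * \<sigma>) + (1 - 1 / 2) * p"
        by (simp add: field_simps)
      moreover have "d / 2 = real m + 1 / 2" "real m + 1 - 1 / 2 = real m + 1 / 2" by (simp_all add: d_def)
      ultimately show ?thesis unfolding d_def by metis
    qed
    ultimately show ?thesis by (simp only: 1)
  next
    case 2
    then show ?thesis by (simp add: frequency_weight_def algebra_simps)
  next
    case 3
    have nz: "1 - \<alpha> + real k \<noteq> 0" for k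
      using 3 assms(1) by (cases k) auto
    define r t where "r = pochhammer \<alpha> m / pochhammer (1 - \<alpha>) m" and "t = tan (pi * \<alpha>)"
    have "pochhammer \<alpha> (Suc m) / pochhammer (1 - \<alpha>) (Suc m) = r * ((\<alpha> + real m) / (1 - \<alpha> + real m))"
      by (simp add: r_def pochhammer_Suc)
    then have s: "frequency_weight (Suc m) \<alpha> = (1 - r * ((\<alpha> + real m) / (1 - \<alpha> + real m))) * t"
      using 3 by (simp add: frequency_weight_def t_def)
    have w: "frequency_weight m \<alpha> = (1 - r) * t" "frequency_weight 1 \<alpha> = (1 - \<alpha> / (1 - \<alpha>)) * t"
      using 3 by (simp_all add: frequency_weight_def r_def t_def)
    have e1: "(real m + 1 - \<alpha>) * (1 - r * ((\<alpha> + real m) / (1 - \<alpha> + real m))) =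
        (real m + 1 - \<alpha>) - r * (\<alpha> + real m)"
      using nz[of m] by (simp add: field_simps)
    have e2: "(1 - \<alpha>) * (1 - \<alpha> / (1 - \<alpha>)) = 1 - 2 * \<alpha>"
      using 3(2) by (simp add: field_simps)
    show ?thesis
      unfolding s w mult.assoc[symmetric] e1 e2 by (simp add: algebra_simps)
  qed
qed

lemma Gamma_legendre_duplication_real:
  fixes x :: real
  assumes "0 < x"
  shows "Gamma x * Gamma (x + 1 / 2) = 2 powr (1 - 2 * x) * sqrt pi * Gamma (2 * x)"
proof -
  have np: "complex_of_real y \<notin> \<int>\<^sub>\<le>\<^sub>0" if "0 < y" for y
    using that by (auto simp: of_real_in_nonpos_Ints_iff elim!: nonpos_Ints_cases)
  have e: "complex_of_real x + 1 / 2 = of_real (x + 1 / 2)" "2 * complex_of_real x = of_real (2 * x)"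
    "(1 - of_real (2 * x)) * complex_of_real (ln 2) = of_real ((1 - 2 * x) * ln 2)"
    by simp_all
  have "complex_of_real (Gamma x * Gamma (x + 1 / 2)) =
      of_real (exp ((1 - 2 * x) * ln 2) * sqrt pi * Gamma (2 * x))"
    using Gamma_legendre_duplication[of "of_real x"] np[of x] np[of "x + 1 / 2"] assms
    unfolding e Gamma_complex_of_real exp_of_real by simp
  then show ?thesis by (simp only: of_real_eq_iff) (simp add: powr_def)
qed

lemma Gamma_reflection_real:
  fixes x :: real
  shows "Gamma x * Gamma (1 - x) = pi / sin (pi * x)"
proof -
  have e: "1 - complex_of_real x = of_real (1 - x)" "of_real pi * complex_of_real x = of_real (pi * x)"
    by simp_all
  have "complex_of_real (Gamma x * Gamma (1 - x)) = of_real (pi / sin (pi * x))"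
    using Gamma_reflection_complex[of "of_real x"] unfolding e Gamma_complex_of_real sin_of_real by simp
  then show ?thesis by (simp only: of_real_eq_iff)
qed

lemma not_nonpos_Ints_if: "x \<notin> \<int>\<^sub>\<le>\<^sub>0" if "-1 < x" "x \<noteq> 0" for x :: real
proof
  assume "x \<in> \<int>\<^sub>\<le>\<^sub>0"
  then obtain n where "x = - real n" by (auto elim: nonpos_Ints_cases')
  with that show False by (cases n) auto
qed

text \<open>
  The Gamma factors of the Beta integral are \<open>\<Gamma>(1/2 - \<alpha>)\<close> and \<open>\<Gamma>(1 - \<alpha>)\<close> up to elementary factors. The
  reflection formula trades them for \<open>\<Gamma>(1/2 + \<alpha>)\<close> and \<open>\<Gamma>(\<alpha>)\<close>, which produces the tangent, and the
  duplication formula then brings in \<open>\<Gamma>(2\<alpha>)\<close>. At \<open>\<alpha> = 1/2\<close> and \<open>\<alpha> = 1\<close> one of the reflected factors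
  has a pole, and the values are computed directly.
\<close>

lemma Beta_eq_frequency_weight_1:
  fixes \<alpha> :: real
  assumes "0 < \<alpha>" "\<alpha> < 3 / 2"
  shows "4 powr (1 - \<alpha>) / 2 * Beta (3 / 2 - \<alpha>) (1 / 2) = (Gamma \<alpha>)\<^sup>2 / (2 * Gamma (2 * \<alpha>)) * frequency_weight 1 \<alpha>"
proof -
  have B: "Beta (3 / 2 - \<alpha>) (1 / 2) = Gamma (3 / 2 - \<alpha>) * sqrt pi / Gamma (2 - \<alpha>)"
    by (simp add: Beta_def Gamma_one_half_real)
  consider "\<alpha> = 1 / 2" | "\<alpha> = 1" | "\<alpha> \<noteq> 1 / 2" "\<alpha> \<noteq> 1" by blast
  then show ?thesis
  proof cases
    case 1
    have g: "Gamma (3 / 2 :: real) = 1 / 2 * sqrt pi"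
      using Gamma_plus1[of "1 / 2 :: real"] not_nonpos_Ints_if[of "1 / 2"]
      by (simp add: Gamma_one_half_real)
    show ?thesis unfolding 1 B[unfolded 1] by (simp add: g frequency_weight_def Gamma_one_half_real powr_half_sqrt)
  next
    case 2
    have "Gamma (2 :: real) = 1" using Gamma_fact[of 1, where ?'a = real] by simp
    then show ?thesis unfolding B using 2 by (simp add: frequency_weight_def Gamma_one_half_real)
  next
    case 3
    define S C where "S = sin (pi * \<alpha>)" and "C = cos (pi * \<alpha>)"
    define G where "G = Gamma \<alpha>"
    define G2 where "G2 = Gamma (2 * \<alpha>)"
    define H where "H = Gamma (\<alpha> + 1 / 2)"
    define q where "q = 2 powr (1 - 2 * \<alpha>)"
    have pos: "0 < G" "0 < G2" "0 < H" "0 < q"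
      using assms by (auto simp: G_def G2_def H_def q_def intro!: Gamma_real_pos)
    have np: "1 / 2 - \<alpha> \<notin> \<int>\<^sub>\<le>\<^sub>0" "1 - \<alpha> \<notin> \<int>\<^sub>\<le>\<^sub>0"
      by (rule not_nonpos_Ints_if; use 3 assms in simp)+
    have r1: "Gamma (3 / 2 - \<alpha>) = (1 / 2 - \<alpha>) * Gamma (1 / 2 - \<alpha>)"
      using Gamma_plus1[OF np(1)] by (simp add: algebra_simps)
    have r2: "Gamma (2 - \<alpha>) = (1 - \<alpha>) * Gamma (1 - \<alpha>)"
      using Gamma_plus1[OF np(2)] by (simp add: algebra_simps)
    have "sin (pi * (\<alpha> + 1 / 2)) = C"
      using sin_add[of "pi * \<alpha>" "pi / 2"] by (simp add: C_def algebra_simps)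
    then have f1: "H * Gamma (1 / 2 - \<alpha>) = pi / C"
      using Gamma_reflection_real[of "\<alpha> + 1 / 2"] by (simp add: H_def algebra_simps)
    have f2: "G * Gamma (1 - \<alpha>) = pi / S"
      using Gamma_reflection_real[of \<alpha>] by (simp add: G_def S_def)
    have f3: "G * H = q * sqrt pi * G2"
      using Gamma_legendre_duplication_real[OF assms(1)] by (simp add: G_def H_def G2_def q_def)
    have gn: "Gamma (1 / 2 - \<alpha>) \<noteq> 0" "Gamma (1 - \<alpha>) \<noteq> 0"
      using np by (auto simp: Gamma_eq_zero_iff)
    have nz: "C \<noteq> 0" "S \<noteq> 0" using f1 f2 gn pos by auto
    have a1: "Gamma (1 / 2 - \<alpha>) = pi / (C * H)" using f1 pos nz by (simp add: field_simps)
    have a2: "Gamma (1 - \<alpha>) = pi / (S * G)" using f2 pos nz by (simp add: field_simps)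
    have q: "4 powr (1 - \<alpha>) = 2 * q"
      using powr_powr[of 2 2 "1 - \<alpha>"] powr_add[of 2 1 "1 - 2 * \<alpha>"] by (simp add: q_def algebra_simps)
    have H: "H = q * sqrt pi * G2 / G" using f3 pos by (simp add: field_simps)
    have w: "frequency_weight 1 \<alpha> = (1 - 2 * \<alpha>) / (1 - \<alpha>) * (S / C)"
      using 3 by (simp add: frequency_weight_def tan_def S_def C_def field_simps)
    have "4 powr (1 - \<alpha>) / 2 * Beta (3 / 2 - \<alpha>) (1 / 2) =
        q * ((1 / 2 - \<alpha>) * (pi / (C * H)) * sqrt pi / ((1 - \<alpha>) * (pi / (S * G))))"
      unfolding B r1 r2 a1 a2 q by simp
    also have "\<dots> = (1 / 2 - \<alpha>) / (1 - \<alpha>) * (S / C) * (G * (q * sqrt pi) / H)"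
      using pos nz by (simp add: mult_ac)
    also have "G * (q * sqrt pi) / H = G\<^sup>2 / G2"
      unfolding H using pos by (simp add: power2_eq_square)
    also have "(1 / 2 - \<alpha>) / (1 - \<alpha>) * (S / C) * (G\<^sup>2 / G2) = G\<^sup>2 / (2 * G2) * frequency_weight 1 \<alpha>"
      unfolding w by (simp add: field_simps)
    finally show ?thesis by (simp add: G_def G2_def)
  qed
qed

text \<open>
  Convergence of the integral is part of the induction: its integrand at frequency \<open>m + 1\<close> is a
  combination of those at \<open>m\<close> and \<open>1\<close> and of the one of integral \<open>0\<close>. The coefficient
  \<open>m + 1 - \<alpha>\<close> by which one divides is positive for \<open>m \<ge> 1\<close>.
\<close>

lemma has_integral_one_minus_cos:
  fixes \<alpha> :: real and m :: nat
  assumes "0 < \<alpha>" "\<alpha> < 3 / 2" "m \<ge> 1"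
  shows "((\<lambda>\<theta>. symbol \<theta> powr (- \<alpha>) * (1 - cos (real m * \<theta>))) has_integral
           (Gamma \<alpha>)\<^sup>2 / (2 * Gamma (2 * \<alpha>)) * frequency_weight m \<alpha>) {0..pi}"
  using assms(3)
proof (induction m rule: dec_induct)
  case base
  show ?case using has_integral_one_minus_cos_1[OF assms(2)] unfolding Beta_eq_frequency_weight_1[OF assms(1,2)] by simp
next
  case (step m)
  let ?K = "(Gamma \<alpha>)\<^sup>2 / (2 * Gamma (2 * \<alpha>))"
  let ?W = "\<lambda>m \<theta>. symbol \<theta> powr (- \<alpha>) * (1 - cos (real m * \<theta>))"
  have nz: "real m + 1 - \<alpha> \<noteq> 0" using step assms by linarith
  have one: "(?W 1 has_integral ?K * frequency_weight 1 \<alpha>) {0..pi}"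
    using has_integral_one_minus_cos_1[OF assms(2)] unfolding Beta_eq_frequency_weight_1[OF assms(1,2)] by simp
  have "((\<lambda>\<theta>. (1 / (real m + 1 - \<alpha>)) * (symbol \<theta> powr (- \<alpha>) *
            ((real m + 1 - \<alpha>) * (1 - cos (real (Suc m) * \<theta>)) - (real m + \<alpha>) * (1 - cos (real m * \<theta>))
              - (1 - \<alpha>) * (1 - cos \<theta>)) + (real m + \<alpha>) * ?W m \<theta> + (1 - \<alpha>) * ?W 1 \<theta>))
      has_integral (1 / (real m + 1 - \<alpha>)) * (0 + (real m + \<alpha>) * (?K * frequency_weight m \<alpha>)
        + (1 - \<alpha>) * (?K * frequency_weight 1 \<alpha>))) {0..pi}"
    by (intro has_integral_mult_right has_integral_add has_integral_one_minus_cos_recurrence assms step one)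
  moreover have "(1 / (real m + 1 - \<alpha>)) * (0 + (real m + \<alpha>) * (?K * frequency_weight m \<alpha>)
        + (1 - \<alpha>) * (?K * frequency_weight 1 \<alpha>)) =
      ?K * ((real m + \<alpha>) * frequency_weight m \<alpha> + (1 - \<alpha>) * frequency_weight 1 \<alpha>) / (real m + 1 - \<alpha>)"
    using nz by (simp add: divide_simps) (simp add: algebra_simps)
  moreover have "\<dots> = ?K * frequency_weight (Suc m) \<alpha>"
    unfolding frequency_weight_recurrence[OF assms(2) step(1), symmetric] using nz by simp
  moreover have "(1 / (real m + 1 - \<alpha>)) * (symbol \<theta> powr (- \<alpha>) *
            ((real m + 1 - \<alpha>) * (1 - cos (real (Suc m) * \<theta>)) - (real m + \<alpha>) * (1 - cos (real m * \<theta>))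
              - (1 - \<alpha>) * (1 - cos \<theta>)) + (real m + \<alpha>) * ?W m \<theta> + (1 - \<alpha>) * ?W 1 \<theta>) = ?W (Suc m) \<theta>" for \<theta>
  proof -
    have "(1 / d) * (w * (d * x - b * y - c * z) + b * (w * y) + c * (w * z)) = w * x"
      if "d \<noteq> 0" for d w x b y c z :: real
      using that by (simp add: field_simps)
    from this[OF nz] show ?thesis by simp
  qed
  ultimately show ?case by simp
qed

text \<open>
  The diagonal entry \<open>\<langle>e\<^sub>n, (- \<Delta>) powr (- \<alpha>) e\<^sub>n\<rangle>\<close> of the Green kernel, in closed form.
\<close>

definition green_diagonal :: "real \<Rightarrow> nat \<Rightarrow> real" where
  "green_diagonal \<alpha> n = (Gamma \<alpha>)\<^sup>2 / (2 * pi * Gamma (2 * \<alpha>)) * g_weight n \<alpha>"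

lemma has_integral_green_diagonal:
  fixes \<alpha> :: real and n :: nat
  assumes "0 < \<alpha>" "\<alpha> < 3 / 2" "n \<ge> 1"
  shows "((\<lambda>\<theta>. symbol \<theta> powr (- \<alpha>) * (sin (real n * \<theta>))\<^sup>2) has_integral
           pi / 2 * green_diagonal \<alpha> n) {0..pi}"
proof -
  have "((\<lambda>\<theta>. 1 / 2 * (symbol \<theta> powr (- \<alpha>) * (1 - cos (real (2 * n) * \<theta>)))) has_integral
           1 / 2 * ((Gamma \<alpha>)\<^sup>2 / (2 * Gamma (2 * \<alpha>)) * frequency_weight (2 * n) \<alpha>)) {0..pi}"
    using assms by (intro has_integral_mult_right has_integral_one_minus_cos) auto
  moreover have "1 - cos (real (2 * n) * \<theta>) = 2 * (sin (real n * \<theta>))\<^sup>2" for \<theta>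
    using cos_double_sin[of "real n * \<theta>"] by (simp add: mult.assoc)
  ultimately show ?thesis by (simp add: green_diagonal_def g_weight_eq_frequency_weight)
qed

section \<open>Finitely supported sequences\<close>

text \<open>
  Used both to truncate elements of the space and to make elements out of sequences that are
  not square summable. The entry at \<open>0\<close> is erased, as the type demands.
\<close>

lift_definition cut_off :: "nat \<Rightarrow> (nat \<Rightarrow> complex) \<Rightarrow> ell2" is
  "\<lambda>N f n. if 0 < n \<and> n < N then f n else 0"
proof -
  fix N and f :: "nat \<Rightarrow> complex"
  have "summable (\<lambda>n. (norm (if 0 < n \<and> n < N then f n else 0))\<^sup>2)"
    by (rule summable_finite[of "{..<N}"]) auto
  then show "(if 0 < (0::nat) \<and> 0 < N then f 0 else 0) = 0 \<and>
      summable (\<lambda>n. (norm (if 0 < n \<and> n < N then f n else 0))\<^sup>2)"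
    by simp
qed

lemma coord_cut_off: "coord (cut_off N f) n = (if 0 < n \<and> n < N then f n else 0)"
  by (simp add: cut_off.rep_eq)

definition finitely_supported :: "ell2 \<Rightarrow> bool" where
  "finitely_supported \<psi> \<longleftrightarrow> (\<exists>N. \<forall>n\<ge>N. coord \<psi> n = 0)"

lemma finitely_supported_cut_off: "finitely_supported (cut_off N f)"
  unfolding finitely_supported_def by (intro exI[of _ N]) (auto simp: coord_cut_off)

lemma finitely_supported_add:
  assumes "finitely_supported \<phi>" "finitely_supported \<psi>"
  shows "finitely_supported (\<phi> + \<psi>)"
proof -
  from assms obtain M N where "\<forall>n\<ge>M. coord \<phi> n = 0" "\<forall>n\<ge>N. coord \<psi> n = 0"
    unfolding finitely_supported_def by blast
  then show ?thesis unfolding finitely_supported_def by (intro exI[of _ "max M N"]) simp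
qed

lemma finitely_supported_scaleR: "finitely_supported \<psi> \<Longrightarrow> finitely_supported (c *\<^sub>R \<psi>)"
  unfolding finitely_supported_def by auto

lemma finitely_supported_neg_laplacian:
  assumes "finitely_supported \<psi>"
  shows "finitely_supported (neg_laplacian \<psi>)"
proof -
  from assms obtain N where N: "\<forall>n\<ge>N. coord \<psi> n = 0"
    unfolding finitely_supported_def by blast
  have "coord (neg_laplacian \<psi>) n = 0" if "n \<ge> Suc N" for n
    using N that by (simp add: neg_laplacian.rep_eq coord_neg_laplacian_fun)
  then show ?thesis unfolding finitely_supported_def by blast
qed

lemma cut_off_tendsto: "(\<lambda>N. cut_off N (coord \<psi>)) \<longlonglongrightarrow> \<psi>"
proof -
  let ?a = "\<lambda>n. (norm (coord \<psi> n))\<^sup>2"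
  have "(norm (cut_off N (coord \<psi>) - \<psi>))\<^sup>2 = (\<Sum>n. ?a n) - (\<Sum>n<N. ?a n)" for N
  proof -
    let ?t = "\<lambda>n. if n < N then ?a n else 0"
    have t: "summable ?t" "(\<Sum>n. ?t n) = (\<Sum>n<N. ?a n)"
      by (rule summable_finite[of "{..<N}"], auto)
        (subst suminf_finite[of "{..<N}"], auto)
    have "(norm (cut_off N (coord \<psi>) - \<psi>))\<^sup>2 = (\<Sum>n. ?a n - ?t n)"
      unfolding norm_ell2_sq by (rule suminf_cong) (auto simp: coord_cut_off)
    also have "\<dots> = (\<Sum>n. ?a n) - (\<Sum>n. ?t n)"
      by (rule suminf_diff[OF summable_coord t(1), symmetric])
    finally show ?thesis unfolding t(2) .
  qed
  moreover have "(\<lambda>N. (\<Sum>n. ?a n) - (\<Sum>n<N. ?a n)) \<longlonglongrightarrow> (\<Sum>n. ?a n) - (\<Sum>n. ?a n)"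
    by (intro tendsto_intros summable_LIMSEQ summable_coord)
  ultimately have "(\<lambda>N. (norm (cut_off N (coord \<psi>) - \<psi>))\<^sup>2) \<longlonglongrightarrow> 0" by simp
  then have "(\<lambda>N. sqrt ((norm (cut_off N (coord \<psi>) - \<psi>))\<^sup>2)) \<longlonglongrightarrow> sqrt 0"
    by (rule tendsto_real_sqrt)
  then have "(\<lambda>N. norm (cut_off N (coord \<psi>) - \<psi>)) \<longlonglongrightarrow> 0" by simp
  then show ?thesis by (rule LIM_zero_cancel[OF tendsto_norm_zero_cancel])
qed

text \<open>
  Density of the finitely supported sequences, as a proof principle for closed properties.
\<close>

lemma finitely_supported_dense:
  assumes "closed {\<psi>. P \<psi>}" "\<And>\<psi>. finitely_supported \<psi> \<Longrightarrow> P \<psi>"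
  shows "P \<psi>"
proof -
  have "\<psi> \<in> {\<psi>. P \<psi>}"
    by (rule closed_sequentially[OF assms(1) _ cut_off_tendsto])
      (simp add: assms(2) finitely_supported_cut_off)
  then show ?thesis by simp
qed

section \<open>The sine transform\<close>

definition sine_transform :: "ell2 \<Rightarrow> real \<Rightarrow> complex" where
  "sine_transform \<psi> \<theta> = (\<Sum>n. coord \<psi> n * of_real (sin (real n * \<theta>)))"

lemma sine_transform_eq_sum:
  assumes "\<forall>n\<ge>N. coord \<psi> n = 0"
  shows "sine_transform \<psi> \<theta> = (\<Sum>n<N. coord \<psi> n * of_real (sin (real n * \<theta>)))"
  unfolding sine_transform_def using assms by (intro suminf_finite) auto

lemma sine_transform_add:
  assumes "finitely_supported \<phi>" "finitely_supported \<psi>"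
  shows "sine_transform (\<phi> + \<psi>) \<theta> = sine_transform \<phi> \<theta> + sine_transform \<psi> \<theta>"
proof -
  from assms obtain M N where MN: "\<forall>n\<ge>M. coord \<phi> n = 0" "\<forall>n\<ge>N. coord \<psi> n = 0"
    unfolding finitely_supported_def by blast
  let ?N = "max M N"
  have N: "\<forall>n\<ge>?N. coord \<phi> n = 0" "\<forall>n\<ge>?N. coord \<psi> n = 0" "\<forall>n\<ge>?N. coord (\<phi> + \<psi>) n = 0"
    using MN by auto
  show ?thesis
    unfolding N[THEN sine_transform_eq_sum] by (simp add: ring_distribs sum.distrib)
qed

lemma sine_transform_scaleR:
  assumes "finitely_supported \<psi>"
  shows "sine_transform (c *\<^sub>R \<psi>) \<theta> = of_real c * sine_transform \<psi> \<theta>"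
proof -
  from assms obtain N where N: "\<forall>n\<ge>N. coord \<psi> n = 0"
    unfolding finitely_supported_def by blast
  then have N': "\<forall>n\<ge>N. coord (c *\<^sub>R \<psi>) n = 0" by simp
  show ?thesis
    unfolding sine_transform_eq_sum[OF N] sine_transform_eq_sum[OF N']
    by (simp add: sum_distrib_left scaleR_conv_of_real mult.assoc)
qed

lemma continuous_on_sine_transform:
  assumes "finitely_supported \<psi>"
  shows "continuous_on S (sine_transform \<psi>)"
proof -
  from assms obtain N where N: "\<forall>n\<ge>N. coord \<psi> n = 0"
    unfolding finitely_supported_def by blast
  show ?thesis unfolding sine_transform_eq_sum[OF N] by (intro continuous_intros)
qed

lemma sin_laplacian:
  "- sin (real n * \<theta>) + 2 * sin (real (Suc n) * \<theta>) - sin (real (Suc (Suc n)) * \<theta>) =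
     symbol \<theta> * sin (real (Suc n) * \<theta>)"
proof -
  have "sin (real n * \<theta>) = sin (real (Suc n) * \<theta> - \<theta>)"
    "sin (real (Suc (Suc n)) * \<theta>) = sin (real (Suc n) * \<theta> + \<theta>)"
    by (simp_all add: algebra_simps)
  then show ?thesis unfolding sin_add sin_diff symbol_def by (simp add: algebra_simps)
qed

text \<open>
  Summation by parts moves the second difference from \<open>\<psi>\<close> to the sines, for which it is
  multiplication by the symbol. The boundary term at \<open>0\<close> vanishes because both factors do there.
\<close>

lemma sine_transform_neg_laplacian:
  assumes "finitely_supported \<psi>"
  shows "sine_transform (neg_laplacian \<psi>) \<theta> = of_real (symbol \<theta>) * sine_transform \<psi> \<theta>"
proof -
  define a where "a = coord \<psi>"
  define s where "s = (\<lambda>n. complex_of_real (sin (real n * \<theta>)))"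
  have a0: "a 0 = 0" and s0: "s 0 = 0" by (simp_all add: a_def s_def)
  have s: "- s n + 2 * s (Suc n) - s (Suc (Suc n)) = of_real (symbol \<theta>) * s (Suc n)" for n
    unfolding s_def sin_laplacian[symmetric] of_real_mult[symmetric] by simp
  have l: "coord (neg_laplacian \<psi>) (Suc n) = - a n + 2 * a (Suc n) - a (Suc (Suc n))" for n
    by (simp add: a_def neg_laplacian.rep_eq coord_neg_laplacian_fun)
  \<comment> \<open>the partial sums, with the boundary term at their upper end that later drops out\<close>
  have green: "(\<Sum>n<Suc N. coord (neg_laplacian \<psi>) n * s n) =
      of_real (symbol \<theta>) * (\<Sum>n<Suc N. a n * s n) + a N * s (Suc N) - a (Suc N) * s N" for N
  proof (induction N)
    case 0
    then show ?case by (simp add: a0 s0)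
  next
    case (Suc N)
    have "(\<Sum>n<Suc (Suc N). coord (neg_laplacian \<psi>) n * s n) =
        of_real (symbol \<theta>) * (\<Sum>n<Suc N. a n * s n) + a N * s (Suc N) - a (Suc N) * s N
        + (- a N + 2 * a (Suc N) - a (Suc (Suc N))) * s (Suc N)"
      by (subst sum.lessThan_Suc) (simp only: Suc l)
    also have "\<dots> = of_real (symbol \<theta>) * (\<Sum>n<Suc N. a n * s n)
        + a (Suc N) * (- s N + 2 * s (Suc N) - s (Suc (Suc N)))
        + a (Suc N) * s (Suc (Suc N)) - a (Suc (Suc N)) * s (Suc N)"
      by (simp add: algebra_simps)
    also have "\<dots> = of_real (symbol \<theta>) * (\<Sum>n<Suc (Suc N). a n * s n)
        + a (Suc N) * s (Suc (Suc N)) - a (Suc (Suc N)) * s (Suc N)"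
      unfolding s by (simp add: algebra_simps)
    finally show ?case .
  qed
  from assms obtain N where N: "\<forall>n\<ge>N. coord \<psi> n = 0"
    unfolding finitely_supported_def by blast
  have N': "\<forall>n\<ge>Suc N. coord (neg_laplacian \<psi>) n = 0" "\<forall>n\<ge>Suc N. coord \<psi> n = 0"
    using N by (auto simp: neg_laplacian.rep_eq coord_neg_laplacian_fun)
  have "a N = 0" "a (Suc N) = 0" using N by (auto simp: a_def)
  then show ?thesis
    using green[of N] unfolding N'[THEN sine_transform_eq_sum] s_def a_def by simp
qed

lemma has_integral_cos_int:
  assumes "k \<noteq> 0"
  shows "((\<lambda>\<theta>. cos (of_int k * \<theta>)) has_integral 0) {0..pi}"
proof -
  have "((\<lambda>\<theta>. cos (of_int k * \<theta>)) has_integral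
      (sin (of_int k * pi) / of_int k - sin (of_int k * 0) / of_int k)) {0..pi}"
  proof (rule fundamental_theorem_of_calculus)
    show "((\<lambda>\<theta>. sin (of_int k * \<theta>) / of_int k) has_vector_derivative cos (of_int k * \<theta>))
        (at \<theta> within {0..pi})" for \<theta>
      using assms by (auto intro!: derivative_eq_intros simp flip: has_real_derivative_iff_has_vector_derivative)
  qed simp
  moreover have "sin (of_int k * pi) = 0" by (simp add: sin_zero_iff_int2)
  ultimately show ?thesis by simp
qed

lemma has_integral_sin_sin:
  assumes "0 < m" "0 < n"
  shows "((\<lambda>\<theta>. sin (real m * \<theta>) * sin (real n * \<theta>)) has_integral (if m = n then pi / 2 else 0)) {0..pi}"
proof -
  have s: "((\<lambda>\<theta>. cos (of_int (int m + int n) * \<theta>)) has_integral 0) {0..pi}"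
    using assms by (intro has_integral_cos_int) auto
  have d: "((\<lambda>\<theta>. cos (of_int (int m - int n) * \<theta>)) has_integral (if m = n then pi else 0)) {0..pi}"
  proof (cases "m = n")
    case True
    then show ?thesis using has_integral_const_real[of "1::real" 0 pi] by simp
  next
    case False
    then have "((\<lambda>\<theta>. cos (of_int (int m - int n) * \<theta>)) has_integral 0) {0..pi}"
      by (intro has_integral_cos_int) auto
    then show ?thesis using False by simp
  qed
  have "((\<lambda>\<theta>. 1 / 2 * (cos (of_int (int m - int n) * \<theta>) - cos (of_int (int m + int n) * \<theta>))) has_integral
      1 / 2 * ((if m = n then pi else 0) - 0)) {0..pi}"
    by (intro has_integral_mult_right has_integral_diff s d)
  moreover have "1 / 2 * (cos (of_int (int m - int n) * \<theta>) - cos (of_int (int m + int n) * \<theta>)) =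
      sin (real m * \<theta>) * sin (real n * \<theta>)" for \<theta>
    by (simp add: left_diff_distrib distrib_right cos_diff cos_add)
  ultimately show ?thesis by (simp split: if_splits)
qed

text \<open>
  Orthogonality of the functions \<open>sin (n\<theta>)\<close> on \<open>[0, \<pi>]\<close>, each of square integral \<open>\<pi>/2\<close>.
\<close>

lemma parseval:
  assumes "finitely_supported \<phi>" "finitely_supported \<psi>"
  shows "((\<lambda>\<theta>. cnj (sine_transform \<phi> \<theta>) * sine_transform \<psi> \<theta>) has_integral
           of_real (pi / 2) * cinner_ell2 \<phi> \<psi>) {0..pi}"
proof -
  from assms obtain M N where MN: "\<forall>n\<ge>M. coord \<phi> n = 0" "\<forall>n\<ge>N. coord \<psi> n = 0"
    unfolding finitely_supported_def by blast
  define K where "K = max M N"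
  have K: "\<forall>n\<ge>K. coord \<phi> n = 0" "\<forall>n\<ge>K. coord \<psi> n = 0"
    using MN by (auto simp: K_def)
  define I where "I = (\<lambda>m n :: nat. complex_of_real (if m = n then pi / 2 else 0))"
  have int: "((\<lambda>\<theta>. (cnj (coord \<phi> m) * coord \<psi> n) * of_real (sin (real m * \<theta>) * sin (real n * \<theta>)))
      has_integral (cnj (coord \<phi> m) * coord \<psi> n) * I m n) {0..pi}" for m n
  proof (cases "m = 0 \<or> n = 0")
    case True
    then have "cnj (coord \<phi> m) * coord \<psi> n = 0" by auto
    then show ?thesis by (simp only: mult_zero_left has_integral_0)
  next
    case False
    have "((\<lambda>\<theta>. complex_of_real (sin (real m * \<theta>) * sin (real n * \<theta>))) has_integral I m n) {0..pi}"
      unfolding I_def using False by (intro has_integral_of_real has_integral_sin_sin) auto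
    then show ?thesis by (rule has_integral_mult_right)
  qed
  have "((\<lambda>\<theta>. \<Sum>m<K. \<Sum>n<K. (cnj (coord \<phi> m) * coord \<psi> n) * of_real (sin (real m * \<theta>) * sin (real n * \<theta>)))
      has_integral (\<Sum>m<K. \<Sum>n<K. (cnj (coord \<phi> m) * coord \<psi> n) * I m n)) {0..pi}"
    by (intro has_integral_sum int finite_lessThan)
  moreover have "(\<Sum>m<K. \<Sum>n<K. (cnj (coord \<phi> m) * coord \<psi> n) * of_real (sin (real m * \<theta>) * sin (real n * \<theta>)))
      = cnj (sine_transform \<phi> \<theta>) * sine_transform \<psi> \<theta>" for \<theta>
    unfolding sine_transform_eq_sum[OF K(1)] sine_transform_eq_sum[OF K(2)]
    by (simp only: cnj_sum sum_product) (simp add: mult_ac)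
  moreover have "(\<Sum>m<K. \<Sum>n<K. (cnj (coord \<phi> m) * coord \<psi> n) * I m n) = of_real (pi / 2) * cinner_ell2 \<phi> \<psi>"
  proof -
    have "(\<Sum>m<K. \<Sum>n<K. (cnj (coord \<phi> m) * coord \<psi> n) * I m n) =
        (\<Sum>m<K. of_real (pi / 2) * (cnj (coord \<phi> m) * coord \<psi> m))"
    proof (rule sum.cong[OF refl])
      fix m assume m: "m \<in> {..<K}"
      have "(\<Sum>n<K. (cnj (coord \<phi> m) * coord \<psi> n) * I m n) =
          (\<Sum>n<K. if m = n then of_real (pi / 2) * (cnj (coord \<phi> m) * coord \<psi> m) else 0)"
        by (rule sum.cong) (auto simp: I_def)
      then show "(\<Sum>n<K. (cnj (coord \<phi> m) * coord \<psi> n) * I m n) =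
          of_real (pi / 2) * (cnj (coord \<phi> m) * coord \<psi> m)"
        using m by simp
    qed
    moreover have "cinner_ell2 \<phi> \<psi> = (\<Sum>m<K. cnj (coord \<phi> m) * coord \<psi> m)"
      unfolding cinner_ell2_def using K by (intro suminf_finite) auto
    ultimately show ?thesis by (simp add: sum_distrib_left)
  qed
  ultimately show ?thesis by simp
qed

lemma parseval_norm:
  assumes "finitely_supported \<psi>"
  shows "((\<lambda>\<theta>. (norm (sine_transform \<psi> \<theta>))\<^sup>2) has_integral pi / 2 * (norm \<psi>)\<^sup>2) {0..pi}"
proof -
  have "((\<lambda>\<theta>. Re (cnj (sine_transform \<psi> \<theta>) * sine_transform \<psi> \<theta>)) has_integral
      Re (of_real (pi / 2) * cinner_ell2 \<psi> \<psi>)) {0..pi}"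
    by (rule has_integral_Re[OF parseval[OF assms assms]])
  moreover have "Re (of_real (pi / 2) * cinner_ell2 \<psi> \<psi>) = pi / 2 * (norm \<psi>)\<^sup>2"
    unfolding power2_norm_eq_inner inner_ell2_def by simp
  ultimately show ?thesis unfolding Re_cnj_mult_self by simp
qed

lemma coord_eq_integral:
  assumes "finitely_supported \<psi>" "0 < n"
  shows "((\<lambda>\<theta>. of_real (sin (real n * \<theta>)) * sine_transform \<psi> \<theta>) has_integral
           of_real (pi / 2) * coord \<psi> n) {0..pi}"
proof -
  \<comment> \<open>Parseval with the \<open>n\<close>-th unit vector, whose transform is \<open>sin (n\<theta>)\<close>\<close>
  let ?e = "cut_off (Suc n) (\<lambda>k. if k = n then 1 else 0)"
  have c: "coord ?e k = (if k = n then 1 else 0)" for k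
    using assms(2) by (auto simp: coord_cut_off)
  have "cinner_ell2 ?e \<psi> = (\<Sum>k\<in>{n}. cnj (coord ?e k) * coord \<psi> k)"
    unfolding cinner_ell2_def by (intro suminf_finite) (auto simp: c)
  moreover have "sine_transform ?e \<theta> = of_real (sin (real n * \<theta>))" for \<theta>
    by (subst sine_transform_eq_sum[of "Suc n"]) (auto simp: c)
  ultimately show ?thesis
    using parseval[OF finitely_supported_cut_off assms(1), of "Suc n" "\<lambda>k. if k = n then 1 else 0"]
    by (simp add: c)
qed

section \<open>Functional calculus of the discrete Laplacian\<close>

lemma poly_op_eq_sum:
  assumes "degree p \<le> N"
  shows "poly_op p A = (\<Sum>i\<le>N. coeff p i *\<^sub>R ((\<lambda>B. A o\<^sub>L B) ^^ i) id_blinfun)"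
  unfolding poly_op_def
  by (rule sum.mono_neutral_left) (use assms in \<open>auto simp: coeff_eq_0\<close>)

lemma poly_op_diff: "poly_op (p - q) A = poly_op p A - poly_op q A"
proof -
  let ?N = "max (degree p) (degree q)"
  have "degree (p - q) \<le> ?N" by (rule degree_diff_le_max)
  then show ?thesis
    by (simp add: poly_op_eq_sum[of _ ?N] scaleR_left_diff_distrib sum_subtractf)
qed

lemma poly_op_smult: "poly_op (smult c p) A = c *\<^sub>R poly_op p A"
  using poly_op_eq_sum[of "smult c p" "degree p" A]
  by (simp add: poly_op_def degree_smult_le scaleR_sum_right)

lemma poly_op_pCons: "poly_op (pCons c p) A = c *\<^sub>R id_blinfun + (A o\<^sub>L poly_op p A)"
proof -
  have "poly_op (pCons c p) A =
      (\<Sum>i\<le>Suc (degree p). coeff (pCons c p) i *\<^sub>R ((\<lambda>B. A o\<^sub>L B) ^^ i) id_blinfun)"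
    by (rule poly_op_eq_sum) (rule degree_pCons_le)
  also have "\<dots> = c *\<^sub>R id_blinfun + (\<Sum>i\<le>degree p. coeff p i *\<^sub>R (A o\<^sub>L ((\<lambda>B. A o\<^sub>L B) ^^ i) id_blinfun))"
    by (simp add: sum.atMost_Suc_shift del: sum.atMost_Suc)
  also have "(\<Sum>i\<le>degree p. coeff p i *\<^sub>R (A o\<^sub>L ((\<lambda>B. A o\<^sub>L B) ^^ i) id_blinfun)) = (A o\<^sub>L poly_op p A)"
    unfolding poly_op_def
    by (simp add: bounded_bilinear.sum_right[OF bounded_bilinear_blinfun_compose]
        bounded_bilinear.scaleR_right[OF bounded_bilinear_blinfun_compose])
  finally show ?thesis .
qed

lemma poly_op_0 [simp]: "poly_op 0 A = 0"
  by (simp add: poly_op_def)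

lemma poly_op_1 [simp]: "poly_op 1 A = id_blinfun"
  by (simp add: poly_op_def)

lemma poly_op_commute: "poly_op p A o\<^sub>L A = A o\<^sub>L poly_op p A"
proof (induction p)
  case 0
  show ?case by (simp add: blinfun_eqI blinfun.bilinear_simps)
next
  case (pCons c p)
  have "(c *\<^sub>R id_blinfun + (A o\<^sub>L poly_op p A)) o\<^sub>L A = (A o\<^sub>L (c *\<^sub>R id_blinfun)) + (A o\<^sub>L (poly_op p A o\<^sub>L A))"
    by (rule blinfun_eqI) (simp add: blinfun.bilinear_simps)
  also have "\<dots> = A o\<^sub>L (c *\<^sub>R id_blinfun + (A o\<^sub>L poly_op p A))"
    unfolding pCons by (rule blinfun_eqI) (simp add: blinfun.bilinear_simps)
  finally show ?case unfolding poly_op_pCons .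
qed

text \<open>
  Both orders of composition are needed, because an inverse in the definition of the spectrum is
  two-sided.
\<close>

lemma poly_op_linear_factor:
  "poly_op ([:- z, 1:] * q) A = (A - z *\<^sub>R id_blinfun) o\<^sub>L poly_op q A"
  "poly_op ([:- z, 1:] * q) A = poly_op q A o\<^sub>L (A - z *\<^sub>R id_blinfun)"
proof -
  have "[:- z, 1:] * q = pCons 0 q - smult z q" by simp
  then have e: "poly_op ([:- z, 1:] * q) A = (A o\<^sub>L poly_op q A) - z *\<^sub>R poly_op q A"
    by (simp only: poly_op_diff poly_op_pCons poly_op_smult) simp
  show "poly_op ([:- z, 1:] * q) A = (A - z *\<^sub>R id_blinfun) o\<^sub>L poly_op q A"
    unfolding e by (rule blinfun_eqI) (simp add: blinfun.bilinear_simps)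
  show "poly_op ([:- z, 1:] * q) A = poly_op q A o\<^sub>L (A - z *\<^sub>R id_blinfun)"
    unfolding e poly_op_commute[symmetric] by (rule blinfun_eqI) (simp add: blinfun.bilinear_simps)
qed

lemma poly_op_neg_laplacian_finitely_supported:
  assumes "finitely_supported \<psi>"
  shows "finitely_supported (poly_op p neg_laplacian \<psi>)"
    and "sine_transform (poly_op p neg_laplacian \<psi>) \<theta> = of_real (poly p (symbol \<theta>)) * sine_transform \<psi> \<theta>"
proof (induction p)
  case 0
  { case 1 show ?case by (simp add: finitely_supported_def) }
  { case 2 show ?case by (simp add: sine_transform_def) }
next
  case (pCons c p)
  note fs = pCons(2) and st = pCons(3)
  have e: "poly_op (pCons c p) neg_laplacian \<psi> = c *\<^sub>R \<psi> + neg_laplacian (poly_op p neg_laplacian \<psi>)"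
    by (simp add: poly_op_pCons blinfun.bilinear_simps)
  note fin = finitely_supported_scaleR[OF assms, of c] finitely_supported_neg_laplacian[OF fs]
  {
    case 1
    show ?case unfolding e by (intro finitely_supported_add fin)
  }
  {
    case 2
    show ?case unfolding e
      by (simp add: sine_transform_add[OF fin] sine_transform_scaleR[OF assms]
          sine_transform_neg_laplacian[OF fs] st algebra_simps)
  }
qed

text \<open>
  On the transform side \<open>p(- \<Delta>)\<close> multiplies by \<open>p(2 - 2 cos \<theta>)\<close>, and \<open>2 - 2 cos \<theta>\<close> takes its values
  in \<open>[0, 4]\<close>.
\<close>

lemma norm_poly_op_neg_laplacian_le:
  assumes "\<And>x. x \<in> {0..4} \<Longrightarrow> \<bar>poly p x\<bar> \<le> M"
  shows "norm (poly_op p neg_laplacian) \<le> M"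
proof (rule norm_blinfun_bound)
  show M: "0 \<le> M" using assms[of 0] by simp
  let ?T = "poly_op p neg_laplacian"
  show "norm (?T \<psi>) \<le> M * norm \<psi>" for \<psi>
  proof (rule finitely_supported_dense[where P = "\<lambda>\<psi>. norm (?T \<psi>) \<le> M * norm \<psi>"])
    show "closed {\<psi>. norm (?T \<psi>) \<le> M * norm \<psi>}"
      by (intro closed_Collect_le continuous_intros)
    fix \<psi> :: ell2 assume \<psi>: "finitely_supported \<psi>"
    have "pi / 2 * (norm (?T \<psi>))\<^sup>2 \<le> M\<^sup>2 * (pi / 2 * (norm \<psi>)\<^sup>2)"
    proof (rule has_integral_le)
      show "((\<lambda>\<theta>. (norm (sine_transform (?T \<psi>) \<theta>))\<^sup>2) has_integral pi / 2 * (norm (?T \<psi>))\<^sup>2) {0..pi}"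
        by (intro parseval_norm poly_op_neg_laplacian_finitely_supported \<psi>)
      show "((\<lambda>\<theta>. M\<^sup>2 * (norm (sine_transform \<psi> \<theta>))\<^sup>2) has_integral M\<^sup>2 * (pi / 2 * (norm \<psi>)\<^sup>2)) {0..pi}"
        by (intro has_integral_mult_right parseval_norm \<psi>)
      fix \<theta> :: real
      have "\<bar>poly p (symbol \<theta>)\<bar> \<le> M" using assms symbol_bounds[of \<theta>] by simp
      then have "\<bar>poly p (symbol \<theta>)\<bar>\<^sup>2 \<le> M\<^sup>2" by (intro power_mono) auto
      then show "(norm (sine_transform (?T \<psi>) \<theta>))\<^sup>2 \<le> M\<^sup>2 * (norm (sine_transform \<psi> \<theta>))\<^sup>2"
        unfolding poly_op_neg_laplacian_finitely_supported(2)[OF \<psi>]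
        by (simp add: norm_mult power_mult_distrib mult_right_mono)
    qed
    then have "(norm (?T \<psi>))\<^sup>2 \<le> (M * norm \<psi>)\<^sup>2" by (simp add: power_mult_distrib)
    then show "norm (?T \<psi>) \<le> M * norm \<psi>"
      by (rule power2_le_imp_le) (simp add: M)
  qed
qed

lemma approximating_polynomials:
  fixes f :: "real \<Rightarrow> real"
  assumes "continuous_on {a..b} f"
  obtains q :: "nat \<Rightarrow> real poly" where "uniform_limit {a..b} (\<lambda>k. poly (q k)) f sequentially"
proof -
  have "\<exists>q. \<forall>x\<in>{a..b}. \<bar>f x - poly q x\<bar> < inverse (real (Suc k))" for k
  proof -
    obtain g where g: "real_polynomial_function g" "\<And>x. x \<in> {a..b} \<Longrightarrow> \<bar>f x - g x\<bar> < inverse (real (Suc k))"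
      using Stone_Weierstrass_real_polynomial_function[OF compact_Icc assms, of "inverse (real (Suc k))"] by auto
    then obtain c n where "g = (\<lambda>x. \<Sum>i\<le>n. c i * x ^ i)"
      using real_polynomial_function_iff_sum by blast
    then have "g x = poly (\<Sum>i\<le>n. monom (c i) i) x" for x
      by (simp add: poly_sum poly_monom)
    with g(2) show ?thesis by metis
  qed
  then obtain q where q: "\<And>k x. x \<in> {a..b} \<Longrightarrow> \<bar>f x - poly (q k) x\<bar> < inverse (real (Suc k))" by metis
  have "uniform_limit {a..b} (\<lambda>k. poly (q k)) f sequentially"
  proof (rule uniform_limitI)
    fix e :: real assume "0 < e"
    have "\<forall>\<^sub>F k in sequentially. inverse (real (Suc k)) < e"
      using LIMSEQ_inverse_real_of_nat \<open>0 < e\<close> by (rule order_tendstoD)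
    then show "\<forall>\<^sub>F k in sequentially. \<forall>x\<in>{a..b}. dist (poly (q k) x) (f x) < e"
    proof eventually_elim
      case (elim k)
      show ?case using q[of _ k] elim by (force simp: dist_real_def abs_minus_commute)
    qed
  qed
  then show ?thesis by (rule that)
qed

lemma poly_op_tendsto_0:
  assumes "uniform_limit {0..4} (\<lambda>k. poly (p k)) (\<lambda>_. 0) sequentially"
  shows "(\<lambda>k. poly_op (p k) neg_laplacian) \<longlonglongrightarrow> 0"
proof (rule LIMSEQ_I)
  fix e :: real assume "0 < e"
  then have "\<forall>\<^sub>F k in sequentially. \<forall>x\<in>{0..4}. dist (poly (p k) x) 0 < e / 2"
    using assms by (intro uniform_limitD) auto
  then obtain K where K: "\<forall>k\<ge>K. \<forall>x\<in>{0..4}. dist (poly (p k) x) 0 < e / 2"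
    unfolding eventually_sequentially by blast
  have "norm (poly_op (p k) neg_laplacian) \<le> e / 2" if "k \<ge> K" for k
    by (rule norm_poly_op_neg_laplacian_le) (use K that in \<open>force simp: dist_real_def\<close>)
  then show "\<exists>K. \<forall>k\<ge>K. norm (poly_op (p k) neg_laplacian - 0) < e"
    using \<open>0 < e\<close> by (intro exI[of _ K]) force
qed

lemma poly_op_convergent:
  assumes "uniform_limit {0..4} (\<lambda>k. poly (q k)) f sequentially"
  shows "convergent (\<lambda>k. poly_op (q k) neg_laplacian)"
proof (rule Cauchy_convergent, rule metric_CauchyI)
  fix e :: real assume "0 < e"
  then have "\<forall>\<^sub>F k in sequentially. \<forall>x\<in>{0..4}. dist (poly (q k) x) (f x) < e / 4"
    using assms by (intro uniform_limitD) auto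
  then obtain K where K: "\<And>k x. k \<ge> K \<Longrightarrow> x \<in> {0..4} \<Longrightarrow> dist (poly (q k) x) (f x) < e / 4"
    unfolding eventually_sequentially by blast
  have "dist (poly_op (q m) neg_laplacian) (poly_op (q n) neg_laplacian) < e" if "m \<ge> K" "n \<ge> K" for m n
  proof -
    have "norm (poly_op (q m - q n) neg_laplacian) \<le> e / 2"
    proof (rule norm_poly_op_neg_laplacian_le)
      fix x :: real assume "x \<in> {0..4}"
      from K[OF that(1) this] K[OF that(2) this]
      show "\<bar>poly (q m - q n) x\<bar> \<le> e / 2" unfolding dist_real_def poly_diff by linarith
    qed
    then show ?thesis using \<open>0 < e\<close> by (simp add: dist_norm poly_op_diff)
  qed
  then show "\<exists>K. \<forall>m\<ge>K. \<forall>n\<ge>K. dist (poly_op (q m) neg_laplacian) (poly_op (q n) neg_laplacian) < e" by blast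
qed

text \<open>
  If \<open>z\<close> is outside \<open>[0, 4]\<close>, then \<open>1 / (x - z)\<close> is continuous on \<open>[0, 4]\<close>, and applying approximating
  polynomials to the operator gives, in the limit, an inverse of \<open>- \<Delta> - z\<close>.
\<close>

lemma real_spectrum_neg_laplacian_subset: "real_spectrum neg_laplacian \<subseteq> {0..4}"
proof (rule subsetI, rule ccontr)
  fix z assume z: "z \<in> real_spectrum neg_laplacian" "z \<notin> {0..4}"
  have nz: "x - z \<noteq> 0" if "x \<in> {0..4}" for x using that z(2) by auto
  obtain q where q: "uniform_limit {0..4} (\<lambda>k. poly (q k)) (\<lambda>x. 1 / (x - z)) sequentially"
    by (rule approximating_polynomials[of 0 4 "\<lambda>x. 1 / (x - z)"]) (use nz in \<open>auto intro!: continuous_intros\<close>)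
  obtain B where B: "(\<lambda>k. poly_op (q k) neg_laplacian) \<longlonglongrightarrow> B"
    using poly_op_convergent[OF q] by (auto simp: convergent_def)
  let ?A = "neg_laplacian - z *\<^sub>R id_blinfun"
  have "uniform_limit {0..4} (\<lambda>k x. (x - z) * (poly (q k) x - 1 / (x - z))) (\<lambda>x. (x - z) * 0) sequentially"
  proof (rule bounded_bilinear.bounded_uniform_limit[OF bounded_bilinear_mult])
    have "uniform_limit {0..4} (\<lambda>_::nat. \<lambda>x. 1 / (x - z)) (\<lambda>x. 1 / (x - z)) sequentially"
      by (rule uniform_limit_const)
    from uniform_limit_minus[OF q this]
    show "uniform_limit {0..4} (\<lambda>k x. poly (q k) x - 1 / (x - z)) (\<lambda>x. 0) sequentially"
      by simp
    show "bounded ((\<lambda>x. x - z) ` {0..4})"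
      by (intro compact_imp_bounded compact_continuous_image continuous_intros compact_Icc)
    show "bounded ((\<lambda>_::real. 0::real) ` {0..4})"
      by (rule bounded_subset[of "{0}"]) auto
  qed (rule uniform_limit_const)
  then have "uniform_limit {0..4} (\<lambda>k. poly ([:- z, 1:] * q k - 1)) (\<lambda>x. 0) sequentially"
    by (rule uniform_limit_cong'[THEN iffD1, rotated -1]) (use nz in \<open>auto simp: field_simps\<close>)
  then have "(\<lambda>k. poly_op ([:- z, 1:] * q k - 1) neg_laplacian) \<longlonglongrightarrow> 0"
    by (rule poly_op_tendsto_0)
  then have lim: "(\<lambda>k. poly_op ([:- z, 1:] * q k) neg_laplacian) \<longlonglongrightarrow> id_blinfun"
    unfolding poly_op_diff poly_op_1 by (rule LIM_zero_cancel)
  have "(\<lambda>k. poly_op ([:- z, 1:] * q k) neg_laplacian) \<longlonglongrightarrow> (?A o\<^sub>L B)"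
    unfolding poly_op_linear_factor(1) by (intro tendsto_intros B)
  then have "?A o\<^sub>L B = id_blinfun" using lim by (rule LIMSEQ_unique)
  moreover have "(\<lambda>k. poly_op ([:- z, 1:] * q k) neg_laplacian) \<longlonglongrightarrow> (B o\<^sub>L ?A)"
    unfolding poly_op_linear_factor(2) by (intro tendsto_intros B)
  then have "B o\<^sub>L ?A = id_blinfun" using lim by (rule LIMSEQ_unique)
  ultimately show False using z(1) by (auto simp: real_spectrum_def)
qed

text \<open>
  By the subtraction formula \<open>|sin \<theta>| \<le> |sin ((n + 1)\<theta>)| + |sin (n\<theta>)|\<close> for all \<open>n\<close>.
\<close>

lemma sin_multiples_not_null:
  assumes "sin \<theta> \<noteq> 0"
  shows "\<not> (\<lambda>n. sin (real n * \<theta>)) \<longlonglongrightarrow> 0"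
proof
  assume s: "(\<lambda>n. sin (real n * \<theta>)) \<longlonglongrightarrow> 0"
  have "\<bar>sin \<theta>\<bar> \<le> \<bar>sin (real (Suc n) * \<theta>)\<bar> + \<bar>sin (real n * \<theta>)\<bar>" for n
  proof -
    have "real (Suc n) * \<theta> - real n * \<theta> = \<theta>" by (simp add: algebra_simps)
    then have "\<bar>sin \<theta>\<bar> = \<bar>sin (real (Suc n) * \<theta>) * cos (real n * \<theta>) - cos (real (Suc n) * \<theta>) * sin (real n * \<theta>)\<bar>"
      by (metis sin_diff)
    also have "\<dots> \<le> \<bar>sin (real (Suc n) * \<theta>)\<bar> * \<bar>cos (real n * \<theta>)\<bar> + \<bar>cos (real (Suc n) * \<theta>)\<bar> * \<bar>sin (real n * \<theta>)\<bar>"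
      unfolding abs_mult[symmetric] by (rule abs_triangle_ineq4)
    also have "\<dots> \<le> \<bar>sin (real (Suc n) * \<theta>)\<bar> * 1 + 1 * \<bar>sin (real n * \<theta>)\<bar>"
      by (intro add_mono mult_mono abs_cos_le_one) auto
    finally show ?thesis by simp
  qed
  moreover have "(\<lambda>n. \<bar>sin (real (Suc n) * \<theta>)\<bar> + \<bar>sin (real n * \<theta>)\<bar>) \<longlonglongrightarrow> \<bar>0\<bar> + \<bar>0\<bar>"
    by (intro tendsto_intros s LIMSEQ_Suc[OF s])
  ultimately have "\<bar>sin \<theta>\<bar> \<le> \<bar>0\<bar> + \<bar>0\<bar>"
    by (intro LIMSEQ_le_const) auto
  then show False using assms by simp
qed

text \<open>
  For \<open>z = 2 - 2 cos \<theta>\<close> the sequence \<open>sin (n\<theta>)\<close> is a bounded solution of \<open>- \<Delta> u = z u\<close> that is not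
  square summable. Cut off at \<open>M\<close>, its norm tends to infinity, whereas \<open>- \<Delta> - z\<close> sends it to a vector
  supported at \<open>M\<close> and \<open>M + 1\<close> with bounded entries; so \<open>- \<Delta> - z\<close> has no bounded left inverse.
\<close>

lemma real_spectrum_neg_laplacian_supset: "{0<..<4} \<subseteq> real_spectrum neg_laplacian"
proof
  fix z :: real assume z: "z \<in> {0<..<4}"
  define \<theta> where "\<theta> = arccos (1 - z / 2)"
  have \<theta>: "0 < \<theta>" "\<theta> < pi"
    using z arccos_lt_bounded[of "1 - z / 2"] by (auto simp: \<theta>_def)
  have sym: "symbol \<theta> = z" using z by (simp add: symbol_def \<theta>_def cos_arccos)
  let ?A = "neg_laplacian - z *\<^sub>R id_blinfun"
  define u where "u = (\<lambda>M. cut_off (Suc M) (\<lambda>n. complex_of_real (sin (real n * \<theta>))))"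
  have cu: "coord (u M) n = (if n \<le> M then of_real (sin (real n * \<theta>)) else 0)" for M n
    by (auto simp: u_def coord_cut_off)
  have lap: "- complex_of_real (sin (real n * \<theta>)) + 2 * of_real (sin (real (Suc n) * \<theta>)) -
      of_real (sin (real (Suc (Suc n)) * \<theta>)) = of_real z * of_real (sin (real (Suc n) * \<theta>))" for n
    using arg_cong[OF sin_laplacian[of n \<theta>], of complex_of_real] unfolding sym by (simp del: of_nat_Suc)
  have cA: "coord (?A (u (Suc M))) n =
      (if n = Suc M then of_real (sin (real (Suc (Suc M)) * \<theta>))
       else if n = Suc (Suc M) then - of_real (sin (real (Suc M) * \<theta>)) else 0)" for M n
  proof (cases n)
    case 0
    then show ?thesis by simp
  next
    case (Suc k)
    have "coord (?A (u (Suc M))) n =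
        - coord (u (Suc M)) k + 2 * coord (u (Suc M)) (Suc k) - coord (u (Suc M)) (Suc (Suc k))
        - of_real z * coord (u (Suc M)) (Suc k)"
      unfolding Suc
      by (simp add: blinfun.bilinear_simps neg_laplacian.rep_eq coord_neg_laplacian_fun scaleR_conv_of_real)
    also have "\<dots> = (if n = Suc M then of_real (sin (real (Suc (Suc M)) * \<theta>))
       else if n = Suc (Suc M) then - of_real (sin (real (Suc M) * \<theta>)) else 0)"
    proof -
      consider "k < M" | "k = M" | "k = Suc M" | "k > Suc M" by linarith
      then show ?thesis
        by cases (use lap[of k] in \<open>auto simp: cu Suc algebra_simps\<close>)
    qed
    finally show ?thesis .
  qed
  have nA: "(norm (?A (u (Suc M))))\<^sup>2 \<le> 2" for M
  proof -
    have "(norm (?A (u (Suc M))))\<^sup>2 = (\<Sum>n\<in>{Suc M, Suc (Suc M)}. (norm (coord (?A (u (Suc M))) n))\<^sup>2)"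
      unfolding norm_ell2_sq by (rule suminf_finite) (auto simp: cA)
    also have "\<dots> = \<bar>sin (real (Suc (Suc M)) * \<theta>)\<bar>\<^sup>2 + \<bar>sin (real (Suc M) * \<theta>)\<bar>\<^sup>2"
      unfolding cA by (simp del: of_nat_Suc)
    also have "\<dots> \<le> 1\<^sup>2 + 1\<^sup>2"
      by (intro add_mono power_mono abs_sin_le_one) auto
    finally show ?thesis by simp
  qed
  show "z \<in> real_spectrum neg_laplacian"
  proof (rule ccontr)
    assume "z \<notin> real_spectrum neg_laplacian"
    then obtain B where B: "B o\<^sub>L ?A = id_blinfun" by (auto simp: real_spectrum_def)
    have bd: "(\<Sum>n\<le>M. (sin (real n * \<theta>))\<^sup>2) \<le> (norm B)\<^sup>2 * 2" for M
    proof -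
      have "(\<Sum>n\<le>M. (sin (real n * \<theta>))\<^sup>2) = (\<Sum>n<Suc M. (norm (coord (u (Suc M)) n))\<^sup>2)"
        unfolding lessThan_Suc_atMost by (rule sum.cong) (auto simp: cu)
      also have "\<dots> \<le> (norm (u (Suc M)))\<^sup>2" by (rule sum_coord_le)
      also have "u (Suc M) = B (?A (u (Suc M)))"
        using arg_cong[OF B, of "\<lambda>T. blinfun_apply T (u (Suc M))"] by simp
      also have "(norm (B (?A (u (Suc M)))))\<^sup>2 \<le> (norm B * norm (?A (u (Suc M))))\<^sup>2"
        by (intro power_mono norm_blinfun) auto
      also have "\<dots> \<le> (norm B)\<^sup>2 * 2"
        unfolding power_mult_distrib by (intro mult_left_mono nA) auto
      finally show ?thesis .
    qed
    have "summable (\<lambda>n. (sin (real n * \<theta>))\<^sup>2)"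
      by (rule bounded_imp_summable[OF _ bd]) auto
    then have "(\<lambda>n. (sin (real n * \<theta>))\<^sup>2) \<longlonglongrightarrow> 0" by (rule summable_LIMSEQ_zero)
    then have "(\<lambda>n. sin (real n * \<theta>)) \<longlonglongrightarrow> 0"
      by (simp add: power_tendsto_0_iff)
    moreover have "sin \<theta> \<noteq> 0" using sin_gt_zero[OF \<theta>] by simp
    ultimately show False using sin_multiples_not_null by blast
  qed
qed

text \<open>
  Makes the description defining the functional calculus effective. It determines at most one
  operator, because there are polynomials converging to \<open>f\<close> on \<open>[0, 4]\<close> and hence on the spectrum. The
  limit does not depend on the polynomials, because the spectrum contains \<open>(0, 4)\<close>: if two sequences of
  polynomials have the same uniform limit on it, then their difference tends to \<open>0\<close> uniformly on
  \<open>[0, 4]\<close>, by continuity at the end points.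
\<close>

lemma cont_calculus_neg_laplacian:
  assumes f: "continuous_on {0..4} f"
    and q: "uniform_limit {0..4} (\<lambda>k. poly (q k)) f sequentially"
  shows "(\<lambda>k. poly_op (q k) neg_laplacian) \<longlonglongrightarrow> cont_calculus f neg_laplacian"
proof -
  let ?S = "real_spectrum neg_laplacian"
  obtain T where T: "(\<lambda>k. poly_op (q k) neg_laplacian) \<longlonglongrightarrow> T"
    using poly_op_convergent[OF q] by (auto simp: convergent_def)
  have qS: "uniform_limit ?S (\<lambda>k. poly (q k)) f sequentially"
    using q real_spectrum_neg_laplacian_subset by (rule uniform_limit_on_subset)
  have "cont_calculus f neg_laplacian = T"
    unfolding cont_calculus_def
  proof (rule the_equality)
    show "\<forall>p. uniform_limit ?S (\<lambda>k. poly (p k)) f sequentially \<longrightarrow>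
        (\<lambda>k. poly_op (p k) neg_laplacian) \<longlonglongrightarrow> T"
    proof (intro allI impI)
      fix p :: "nat \<Rightarrow> real poly"
      assume "uniform_limit ?S (\<lambda>k. poly (p k)) f sequentially"
      then have "uniform_limit ?S (\<lambda>k x. poly (p k) x - poly (q k) x) (\<lambda>x. f x - f x) sequentially"
        using qS by (rule uniform_limit_minus)
      then have lS: "uniform_limit ?S (\<lambda>k. poly (p k - q k)) (\<lambda>x. 0) sequentially"
        by (simp add: poly_diff[abs_def])
      have "uniform_limit {0..4} (\<lambda>k. poly (p k - q k)) (\<lambda>x. 0) sequentially"
      proof (rule uniform_limitI)
        fix e :: real assume "0 < e"
        then have "\<forall>\<^sub>F k in sequentially. \<forall>x\<in>?S. dist (poly (p k - q k) x) 0 < e / 2"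
          using uniform_limitD[OF lS, of "e / 2"] by simp
        then show "\<forall>\<^sub>F k in sequentially. \<forall>x\<in>{0..4}. dist (poly (p k - q k) x) 0 < e"
        proof eventually_elim
          case (elim k)
          have "{0..4} = closure {0<..<4::real}" by simp
          also have "\<dots> \<subseteq> {x. \<bar>poly (p k - q k) x\<bar> \<le> e / 2}"
          proof (rule closure_minimal)
            show "{0<..<4} \<subseteq> {x. \<bar>poly (p k - q k) x\<bar> \<le> e / 2}"
              using elim real_spectrum_neg_laplacian_supset by (force simp: less_imp_le)
            show "closed {x. \<bar>poly (p k - q k) x\<bar> \<le> e / 2}"
              by (intro closed_Collect_le continuous_intros)
          qed
          finally show ?case using \<open>0 < e\<close> by force
        qed
      qed
      then have "(\<lambda>k. poly_op (p k - q k) neg_laplacian) \<longlonglongrightarrow> 0" by (rule poly_op_tendsto_0)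
      from tendsto_add[OF this T] show "(\<lambda>k. poly_op (p k) neg_laplacian) \<longlonglongrightarrow> T"
        by (simp add: poly_op_diff)
    qed
    show "T' = T" if "\<forall>p. uniform_limit ?S (\<lambda>k. poly (p k)) f sequentially \<longrightarrow>
        (\<lambda>k. poly_op (p k) neg_laplacian) \<longlonglongrightarrow> T'" for T'
      using that qS T LIMSEQ_unique by blast
  qed
  with T show ?thesis by simp
qed

section \<open>The quadratic form of a function of the Laplacian\<close>

text \<open>
  The real inner product only sees the real part of the complex one; the imaginary part is the
  real inner product after one argument has been multiplied by the imaginary unit.
\<close>

lift_definition mult_ii :: "ell2 \<Rightarrow> ell2" is "\<lambda>u n. \<i> * u n"
  by (simp add: norm_mult)

lemma coord_mult_ii [simp]: "coord (mult_ii u) n = \<i> * coord u n"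
  by (rule mult_ii.rep_eq[THEN fun_cong])

lemma bounded_linear_mult_ii: "bounded_linear mult_ii"
proof (rule bounded_linear_intro)
  show "mult_ii (u + v) = mult_ii u + mult_ii v" for u v
    by (rule ell2_eqI) (simp add: algebra_simps)
  show "mult_ii (r *\<^sub>R u) = r *\<^sub>R mult_ii u" for r u
    by (rule ell2_eqI) simp
  have "(norm (mult_ii u))\<^sup>2 = (norm u)\<^sup>2" for u
    unfolding norm_ell2_sq by (simp add: norm_mult)
  then show "norm (mult_ii u) \<le> norm u * 1" for u
    by (simp add: power2_eq_iff_nonneg)
qed

lemma Im_cinner_ell2: "Im (cinner_ell2 u v) = inner (mult_ii u) v"
proof -
  have "cinner_ell2 (mult_ii u) v = (\<Sum>n. - \<i> * (cnj (coord u n) * coord v n))"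
    unfolding cinner_ell2_def by (simp add: mult.assoc)
  also have "\<dots> = - \<i> * cinner_ell2 u v"
    unfolding cinner_ell2_def by (rule suminf_mult[OF summable_cinner])
  finally show ?thesis by (simp add: inner_ell2_def)
qed

lemma bounded_linear_coord: "bounded_linear (\<lambda>u. coord u n)"
  by (rule bounded_linear_intro[of _ 1]) (simp_all add: norm_coord_le)

lemma poly_op_form:
  assumes "finitely_supported \<psi>"
  shows "((\<lambda>\<theta>. poly p (symbol \<theta>) * (norm (sine_transform \<psi> \<theta>))\<^sup>2) has_integral
           pi / 2 * inner \<psi> (poly_op p neg_laplacian \<psi>)) {0..pi}"
    and "inner (mult_ii \<psi>) (poly_op p neg_laplacian \<psi>) = 0"
proof -
  let ?c = "cinner_ell2 \<psi> (poly_op p neg_laplacian \<psi>)"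
  note P = poly_op_neg_laplacian_finitely_supported[OF assms, of p]
  have e: "cnj z * (of_real r * z) = of_real (r * (norm z)\<^sup>2)" for z :: complex and r :: real
    using complex_norm_square[of z] by (simp add: mult_ac)
  have int: "((\<lambda>\<theta>. complex_of_real (poly p (symbol \<theta>) * (norm (sine_transform \<psi> \<theta>))\<^sup>2)) has_integral
      of_real (pi / 2) * ?c) {0..pi}"
    using parseval[OF assms P(1)] unfolding P(2) e .
  have "Re (of_real (pi / 2) * ?c) = pi / 2 * inner \<psi> (poly_op p neg_laplacian \<psi>)"
    by (simp add: inner_ell2_def)
  then show "((\<lambda>\<theta>. poly p (symbol \<theta>) * (norm (sine_transform \<psi> \<theta>))\<^sup>2) has_integral
           pi / 2 * inner \<psi> (poly_op p neg_laplacian \<psi>)) {0..pi}"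
    using has_integral_Re[OF int] by simp
  have "((\<lambda>\<theta>. 0::real) has_integral Im (of_real (pi / 2) * ?c)) {0..pi}"
    using has_integral_Im[OF int] by simp
  then have "Im (of_real (pi / 2) * ?c) = 0" by (rule has_integral_unique[OF _ has_integral_0])
  then show "inner (mult_ii \<psi>) (poly_op p neg_laplacian \<psi>) = 0"
    by (simp add: Im_cinner_ell2)
qed

text \<open>
  The vanishing of the imaginary part of the complex form: it vanishes for polynomials, where
  the form is the integral of a real function.
\<close>

lemma cont_calculus_form_real:
  assumes f: "continuous_on {0..4} f"
  shows "inner (mult_ii \<psi>) (cont_calculus f neg_laplacian \<psi>) = 0"
proof (rule finitely_supported_dense[where P = "\<lambda>\<psi>. inner (mult_ii \<psi>) (cont_calculus f neg_laplacian \<psi>) = 0"])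
  show "closed {\<psi>. inner (mult_ii \<psi>) (cont_calculus f neg_laplacian \<psi>) = 0}"
    by (intro closed_Collect_eq continuous_intros bounded_linear.continuous_on[OF bounded_linear_mult_ii])
  fix \<psi> :: ell2 assume \<psi>: "finitely_supported \<psi>"
  obtain q where q: "uniform_limit {0..4} (\<lambda>k. poly (q k)) f sequentially"
    using approximating_polynomials[OF f] .
  have "(\<lambda>k. inner (mult_ii \<psi>) (poly_op (q k) neg_laplacian \<psi>)) \<longlonglongrightarrow>
      inner (mult_ii \<psi>) (cont_calculus f neg_laplacian \<psi>)"
    by (intro tendsto_intros cont_calculus_neg_laplacian f q)
  then have "(\<lambda>k::nat. 0::real) \<longlonglongrightarrow> inner (mult_ii \<psi>) (cont_calculus f neg_laplacian \<psi>)"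
    unfolding poly_op_form(2)[OF \<psi>] .
  then show "inner (mult_ii \<psi>) (cont_calculus f neg_laplacian \<psi>) = 0"
    by (rule LIMSEQ_unique[OF _ tendsto_const])
qed

lemma cont_calculus_form:
  assumes f: "continuous_on {0..4} f" and \<psi>: "finitely_supported \<psi>"
  shows "((\<lambda>\<theta>. f (symbol \<theta>) * (norm (sine_transform \<psi> \<theta>))\<^sup>2) has_integral
           pi / 2 * inner \<psi> (cont_calculus f neg_laplacian \<psi>)) {0..pi}"
proof -
  let ?h = "\<lambda>\<theta>. (norm (sine_transform \<psi> \<theta>))\<^sup>2"
  obtain q where q: "uniform_limit {0..4} (\<lambda>k. poly (q k)) f sequentially"
    using approximating_polynomials[OF f] .
  have h: "continuous_on {0..pi} ?h"
    by (intro continuous_intros continuous_on_sine_transform \<psi>)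
  have fs: "continuous_on {0..pi} (\<lambda>\<theta>. f (symbol \<theta>))"
    by (rule continuous_on_compose2[OF f continuous_on_symbol]) (auto simp: symbol_bounds)
  have "uniform_limit {0..pi} (\<lambda>k \<theta>. poly (q k) (symbol \<theta>)) (\<lambda>\<theta>. f (symbol \<theta>)) sequentially"
    by (rule uniform_limit_compose'[OF q]) (auto simp: symbol_bounds)
  then have u: "uniform_limit {0..pi} (\<lambda>k \<theta>. poly (q k) (symbol \<theta>) * ?h \<theta>) (\<lambda>\<theta>. f (symbol \<theta>) * ?h \<theta>) sequentially"
    by (rule bounded_bilinear.bounded_uniform_limit[OF bounded_bilinear_mult _ uniform_limit_const])
      (intro compact_imp_bounded compact_continuous_image fs h compact_Icc)+
  have c: "continuous_on {0..pi} (\<lambda>\<theta>. poly (q k) (symbol \<theta>) * ?h \<theta>)" for k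
    by (intro continuous_intros continuous_on_sine_transform \<psi>)
  obtain I J where IJ: "\<And>k. ((\<lambda>\<theta>. poly (q k) (symbol \<theta>) * ?h \<theta>) has_integral I k) {0..pi}"
    "((\<lambda>\<theta>. f (symbol \<theta>) * ?h \<theta>) has_integral J) {0..pi}" "I \<longlonglongrightarrow> J"
    by (rule uniform_limit_integral[OF u c]) auto
  have "I k = pi / 2 * inner \<psi> (poly_op (q k) neg_laplacian \<psi>)" for k
    by (rule has_integral_unique[OF IJ(1) poly_op_form(1)[OF \<psi>]])
  then have "I = (\<lambda>k. pi / 2 * inner \<psi> (poly_op (q k) neg_laplacian \<psi>))" by (rule ext)
  moreover have "(\<lambda>k. pi / 2 * inner \<psi> (poly_op (q k) neg_laplacian \<psi>)) \<longlonglongrightarrow>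
      pi / 2 * inner \<psi> (cont_calculus f neg_laplacian \<psi>)"
    by (intro tendsto_intros cont_calculus_neg_laplacian f q)
  ultimately have J: "J = pi / 2 * inner \<psi> (cont_calculus f neg_laplacian \<psi>)"
    using IJ(3) LIMSEQ_unique by blast
  show ?thesis using IJ(2) unfolding J .
qed

section \<open>The pointwise bound and the trace condition\<close>

text \<open>
  The Cauchy-Schwarz inequality for integrals follows from the weighted inequality
  \<open>2ab \<le> t a\<^sup>2 + b\<^sup>2 / t\<close> under the integral by optimising over \<open>t\<close>, which is done here. The optimum is
  \<open>t = s / x\<close>; if \<open>x = 0\<close>, a large \<open>t\<close> forces \<open>s = 0\<close>.
\<close>

lemma square_le_mult_if_weighted_AM:
  fixes s x y :: real
  assumes "0 \<le> s" "0 \<le> x" "0 \<le> y" and le: "\<And>t. 0 < t \<Longrightarrow> 2 * s \<le> t * x + y / t"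
  shows "s\<^sup>2 \<le> x * y"
proof (cases "s = 0")
  case False
  then have s: "0 < s" using assms(1) by simp
  show ?thesis
  proof (cases "x = 0")
    case True
    have "2 * s \<le> y * s / (y + 1)" using le[of "(y + 1) / s"] s assms(3) True by simp
    also have "\<dots> \<le> s" using s assms(3) by (simp add: divide_simps)
    finally show ?thesis using s by simp
  next
    case False
    then have x: "0 < x" using assms(2) by simp
    then have "2 * s \<le> s + y * x / s" using le[of "s / x"] s by simp
    then have "s \<le> x * y / s" by (simp add: mult.commute)
    then show ?thesis using s by (simp add: pos_le_divide_eq power2_eq_square)
  qed
qed (use assms in simp)

lemma continuous_on_powr_Icc:
  fixes \<alpha> :: real
  assumes "0 < \<alpha>"
  shows "continuous_on {0..b} (\<lambda>x. x powr \<alpha>)"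
  by (rule continuous_on_powr') (use assms in auto)

text \<open>
  Cauchy-Schwarz with the weights \<open>(2 - 2 cos \<theta>) powr (\<plusminus>\<alpha>)\<close>. In the proof \<open>X\<close> and \<open>Y\<close> are the
  integrals of the two squares, that is, \<open>\<pi>/2\<close> times the form and \<open>\<pi>/2\<close> times \<open>green_diagonal\<close>.
\<close>

lemma coord_sq_le_form:
  assumes \<alpha>: "0 < \<alpha>" "\<alpha> < 3 / 2" and n: "1 \<le> n"
  shows "(norm (coord \<psi> n))\<^sup>2 \<le> green_diagonal \<alpha> n * inner \<psi> (neg_laplacian_power \<alpha> \<psi>)"
proof (rule finitely_supported_dense[where
      P = "\<lambda>\<psi>. (norm (coord \<psi> n))\<^sup>2 \<le> green_diagonal \<alpha> n * inner \<psi> (neg_laplacian_power \<alpha> \<psi>)"])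
  let ?T = "neg_laplacian_power \<alpha>"
  show "closed {\<psi>. (norm (coord \<psi> n))\<^sup>2 \<le> green_diagonal \<alpha> n * inner \<psi> (?T \<psi>)}"
    by (intro closed_Collect_le continuous_intros bounded_linear.continuous_on[OF bounded_linear_coord])
  fix \<psi> :: ell2 assume \<psi>: "finitely_supported \<psi>"
  define f where "f = sine_transform \<psi>"
  define X where "X = pi / 2 * inner \<psi> (?T \<psi>)"
  define Y where "Y = pi / 2 * green_diagonal \<alpha> n"
  define z where "z = complex_of_real (pi / 2) * coord \<psi> n"
  have X: "((\<lambda>\<theta>. symbol \<theta> powr \<alpha> * (norm (f \<theta>))\<^sup>2) has_integral X) {0..pi}"
    unfolding X_def neg_laplacian_power_def f_def
    by (intro cont_calculus_form \<psi> continuous_on_powr_Icc \<alpha>)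
  have Y: "((\<lambda>\<theta>. symbol \<theta> powr (- \<alpha>) * (sin (real n * \<theta>))\<^sup>2) has_integral Y) {0..pi}"
    unfolding Y_def by (rule has_integral_green_diagonal[OF \<alpha> n])
  have z: "((\<lambda>\<theta>. of_real (sin (real n * \<theta>)) * f \<theta>) has_integral z) {0..pi}"
    unfolding z_def f_def using n by (intro coord_eq_integral \<psi>) simp
  have "(norm z)\<^sup>2 \<le> X * Y"
  proof (rule square_le_mult_if_weighted_AM)
    show "0 \<le> X" by (rule has_integral_nonneg[OF X]) simp
    show "0 \<le> Y" by (rule has_integral_nonneg[OF Y]) simp
    fix t :: real assume t: "0 < t"
    let ?g = "\<lambda>\<theta>. (t * (symbol \<theta> powr \<alpha> * (norm (f \<theta>))\<^sup>2) + 1 / t * (symbol \<theta> powr (- \<alpha>) * (sin (real n * \<theta>))\<^sup>2)) / 2"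
    have g: "(?g has_integral (t * X + 1 / t * Y) / 2) {0..pi}"
      by (intro has_integral_divide has_integral_add has_integral_mult_right X Y)
    have "norm (integral {0..pi} (\<lambda>\<theta>. of_real (sin (real n * \<theta>)) * f \<theta>)) \<le> integral {0..pi} ?g"
    proof (rule integral_norm_bound_integral)
      show "(\<lambda>\<theta>. of_real (sin (real n * \<theta>)) * f \<theta>) integrable_on {0..pi}" using z by blast
      show "?g integrable_on {0..pi}" using g by blast
      fix \<theta> :: real assume \<theta>: "\<theta> \<in> {0..pi}"
      show "norm (of_real (sin (real n * \<theta>)) * f \<theta>) \<le> ?g \<theta>"
      \<comment> \<open>at \<open>\<theta> = 0\<close> the symbol vanishes and cannot be divided by, but the sine vanishes as well\<close>
      proof (cases "\<theta> = 0")
        case True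
        then show ?thesis using t by simp
      next
        case False
        then have "0 < symbol \<theta>" using symbol_pos[of \<theta>] \<theta> by (cases "\<theta> = pi") (auto simp: symbol_def)
        define a where "a = sqrt (t * symbol \<theta> powr \<alpha>)"
        have a: "0 < a" "a\<^sup>2 = t * symbol \<theta> powr \<alpha>"
          using t \<open>0 < symbol \<theta>\<close> by (auto simp: a_def)
        have "0 \<le> (a * norm (f \<theta>) - \<bar>sin (real n * \<theta>)\<bar> / a)\<^sup>2" by simp
        also have "\<dots> = a\<^sup>2 * (norm (f \<theta>))\<^sup>2 + 1 / a\<^sup>2 * (sin (real n * \<theta>))\<^sup>2 - 2 * (norm (f \<theta>) * \<bar>sin (real n * \<theta>)\<bar>)"
          using a(1) by (simp add: power2_diff power_mult_distrib power_divide)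
        finally show ?thesis
          unfolding a(2) by (simp add: norm_mult powr_minus field_simps)
      qed
    qed
    then have "norm z \<le> (t * X + 1 / t * Y) / 2"
      unfolding integral_unique[OF z] integral_unique[OF g] .
    then show "2 * norm z \<le> t * X + Y / t" by simp
  qed simp
  then have "(pi / 2)\<^sup>2 * (norm (coord \<psi> n))\<^sup>2 \<le> (pi / 2)\<^sup>2 * (green_diagonal \<alpha> n * inner \<psi> (?T \<psi>))"
    unfolding X_def Y_def z_def norm_mult power_mult_distrib by (simp add: power2_eq_square mult_ac)
  then show "(norm (coord \<psi> n))\<^sup>2 \<le> green_diagonal \<alpha> n * inner \<psi> (?T \<psi>)"
    by (rule mult_left_le_imp_le) simp
qed

text \<open>
  Testing the pointwise bound with the \<open>n\<close>-th unit vector. As the lower bound \<open>1 / \<parallel>(- \<Delta>)\<^sup>\<alpha>\<parallel>\<close> does not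
  depend on \<open>n\<close>, the trace condition makes the potential a bounded sequence, so that the
  diagonal operator is defined on the whole space.
\<close>

lemma green_diagonal_lower_bound:
  assumes \<alpha>: "0 < \<alpha>" "\<alpha> < 3 / 2" and n: "1 \<le> n"
  shows "0 < green_diagonal \<alpha> n" "1 \<le> green_diagonal \<alpha> n * norm (neg_laplacian_power \<alpha>)"
proof -
  let ?T = "neg_laplacian_power \<alpha>"
  define e where "e = cut_off (Suc n) (\<lambda>k. if k = n then 1 else 0)"
  have c: "coord e k = (if k = n then 1 else 0)" for k
    using n by (auto simp: coord_cut_off e_def)
  have "(norm e)\<^sup>2 = (\<Sum>k\<in>{n}. (norm (coord e k))\<^sup>2)"
    unfolding norm_ell2_sq by (rule suminf_finite) (auto simp: c)
  then have e1: "norm e = 1" using norm_ge_zero[of e] by (auto simp: c power2_eq_1_iff)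
  have le: "1 \<le> green_diagonal \<alpha> n * inner e (?T e)"
    using coord_sq_le_form[OF assms, of e] by (simp add: c)
  have "\<bar>inner e (?T e)\<bar> \<le> norm e * norm (?T e)" by (rule Cauchy_Schwarz_ineq2)
  also have "\<dots> \<le> norm ?T" using norm_blinfun[of ?T e] by (simp add: e1)
  finally have b: "\<bar>inner e (?T e)\<bar> \<le> norm ?T" .
  have "0 \<le> pi / 2 * green_diagonal \<alpha> n"
    by (rule has_integral_nonneg[OF has_integral_green_diagonal[OF assms]]) simp
  then have "0 \<le> green_diagonal \<alpha> n" using pi_gt_zero by (simp add: zero_le_mult_iff del: pi_gt_zero)
  moreover have "green_diagonal \<alpha> n \<noteq> 0" using le by auto
  ultimately show "0 < green_diagonal \<alpha> n" by simp
  then have "green_diagonal \<alpha> n * inner e (?T e) \<le> green_diagonal \<alpha> n * norm ?T"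
    using b by (intro mult_left_mono) auto
  with le show "1 \<le> green_diagonal \<alpha> n * norm ?T" by simp
qed

theorem theorem1p3:
  fixes \<alpha> :: real and V :: "nat \<Rightarrow> real"
  assumes "0 < \<alpha>" and "\<alpha> < 3 / 2"
    and "\<And>n. n \<ge> 1 \<Longrightarrow> V n \<ge> 0"
    and "summable (\<lambda>n. g_weight (Suc n) \<alpha> * V (Suc n))"
    and "(\<Sum>n. g_weight (Suc n) \<alpha> * V (Suc n)) \<le> 2 * pi * (Gamma (2 * \<alpha>) / (Gamma \<alpha>)\<^sup>2)"
  shows "form_ge (neg_laplacian_power \<alpha>) V"
  unfolding form_ge_def
proof (intro allI conjI)
  let ?T = "neg_laplacian_power \<alpha>"
  note \<alpha> = assms(1,2)
  define C where "C = (Gamma \<alpha>)\<^sup>2 / (2 * pi * Gamma (2 * \<alpha>))"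
  have C: "0 < C" "C * (2 * pi * (Gamma (2 * \<alpha>) / (Gamma \<alpha>)\<^sup>2)) = 1"
  proof -
    have "0 < Gamma \<alpha>" "0 < Gamma (2 * \<alpha>)" using \<alpha> by (auto intro: Gamma_real_pos)
    then show "0 < C" "C * (2 * pi * (Gamma (2 * \<alpha>) / (Gamma \<alpha>)\<^sup>2)) = 1"
      by (simp_all add: C_def)
  qed
  \<comment> \<open>the terms of the trace \<open>\<Sum> G\<^sub>n V\<^sub>n\<close>, which is at most \<open>1\<close> by the hypothesis\<close>
  define w where "w = (\<lambda>n. green_diagonal \<alpha> (Suc n) * V (Suc n))"
  have w: "w = (\<lambda>n. C * (g_weight (Suc n) \<alpha> * V (Suc n)))"
    by (simp add: w_def green_diagonal_def C_def mult.assoc)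
  have sw: "summable w" unfolding w by (intro summable_mult assms)
  have w1: "suminf w \<le> 1"
  proof -
    have "C * (\<Sum>n. g_weight (Suc n) \<alpha> * V (Suc n)) \<le> C * (2 * pi * (Gamma (2 * \<alpha>) / (Gamma \<alpha>)\<^sup>2))"
      using C(1) by (intro mult_left_mono assms) simp
    then show ?thesis unfolding w suminf_mult[OF assms(4)] C(2) .
  qed
  have w0: "0 \<le> w n" for n
    using green_diagonal_lower_bound(1)[OF \<alpha>, of "Suc n"] assms(3)[of "Suc n"] by (simp add: w_def)
  have Vle: "V (Suc n) \<le> norm ?T" for n
  proof -
    have "w n \<le> 1" using sum_le_suminf[OF sw, of "{n}"] w0 w1 by fastforce
    have "V (Suc n) * 1 \<le> V (Suc n) * (green_diagonal \<alpha> (Suc n) * norm ?T)"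
      using assms(3) green_diagonal_lower_bound(2)[OF \<alpha>] by (intro mult_left_mono) auto
    also have "\<dots> = w n * norm ?T" by (simp add: w_def)
    also have "\<dots> \<le> norm ?T" using \<open>w n \<le> 1\<close> by (simp add: mult_left_le_one_le w0)
    finally show ?thesis by simp
  qed
  fix \<psi> :: ell2
  show dom: "\<psi> \<in> potential_dom V"
    unfolding potential_dom_def
  proof (rule CollectI, rule summable_comparison_test')
    show "summable (\<lambda>n. (norm ?T)\<^sup>2 * (norm (coord \<psi> n))\<^sup>2)" by (intro summable_mult summable_coord)
    fix n
    show "norm ((norm (of_real (V n) * coord \<psi> n))\<^sup>2) \<le> (norm ?T)\<^sup>2 * (norm (coord \<psi> n))\<^sup>2"
    proof (cases n)
      case (Suc k)
      have "\<bar>V n\<bar> \<le> norm ?T" using Vle[of k] assms(3)[of n] Suc by simp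
      then have "\<bar>V n\<bar>\<^sup>2 \<le> (norm ?T)\<^sup>2" by (intro power_mono) auto
      then show ?thesis by (simp add: norm_mult power_mult_distrib mult_right_mono)
    qed simp
  qed
  have Re_le: "inner \<psi> (potential_op V \<psi>) \<le> inner \<psi> (?T \<psi>)"
  proof -
    let ?f = "\<lambda>n. V n * (norm (coord \<psi> n))\<^sup>2"
    let ?E = "inner \<psi> (?T \<psi>)"
    have f: "Re (cnj (coord \<psi> n) * coord (potential_op V \<psi>) n) = ?f n" for n
      unfolding coord_potential_op[OF dom] cmod_power2 by (simp add: power2_eq_square algebra_simps)
    have sf: "summable ?f" using summable_inner_ell2[of \<psi> "potential_op V \<psi>"] unfolding f .
    have sf1: "summable (\<lambda>n. ?f (Suc n))" using sf by (rule summable_Suc_iff[THEN iffD2])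
    have "0 \<le> green_diagonal \<alpha> 1 * ?E"
      using coord_sq_le_form[OF \<alpha> order_refl, of \<psi>] by (rule order_trans[rotated]) simp
    then have E: "0 \<le> ?E"
      using green_diagonal_lower_bound(1)[OF \<alpha> order_refl] by (simp add: zero_le_mult_iff)
    have "inner \<psi> (potential_op V \<psi>) = (\<Sum>n. ?f n)" unfolding inner_ell2_eq f ..
    also have "\<dots> = (\<Sum>n. ?f (Suc n))" using suminf_split_head[OF sf] by simp
    also have "\<dots> \<le> (\<Sum>n. w n * ?E)"
    proof (rule suminf_le[OF _ sf1 summable_mult2[OF sw]])
      fix n
      have "?f (Suc n) \<le> V (Suc n) * (green_diagonal \<alpha> (Suc n) * ?E)"
        using assms(3) by (intro mult_left_mono coord_sq_le_form \<alpha>) auto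
      then show "?f (Suc n) \<le> w n * ?E" by (simp add: w_def mult_ac)
    qed
    also have "\<dots> = suminf w * ?E" by (rule suminf_mult2[OF sw, symmetric])
    also have "\<dots> \<le> 1 * ?E" using w1 E by (rule mult_right_mono)
    finally show ?thesis by simp
  qed
  have "inner (mult_ii \<psi>) (?T \<psi>) = 0"
    unfolding neg_laplacian_power_def
    by (intro cont_calculus_form_real continuous_on_powr_Icc \<alpha>)
  moreover have "inner (mult_ii \<psi>) (potential_op V \<psi>) = 0"
    unfolding inner_ell2_eq coord_potential_op[OF dom] by (simp add: algebra_simps)
  ultimately have "Im (cinner_ell2 \<psi> (?T \<psi> - potential_op V \<psi>)) = 0"
    by (simp add: Im_cinner_ell2 inner_diff_right)
  moreover have "0 \<le> Re (cinner_ell2 \<psi> (?T \<psi> - potential_op V \<psi>))"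
    using Re_le unfolding inner_ell2_def[symmetric] inner_diff_right by simp
  ultimately show "cinner_ell2 \<psi> (?T \<psi> - potential_op V \<psi>) \<in> \<real>\<^sub>\<ge>\<^sub>0"
    by (simp add: complex_nonneg_Reals_iff)
qed

end
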